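(* As $d\to\infty$, \[ \theta(d)\geq (1-o(1))\frac{d\log d}{2^{d+1}}\,, \] i.e. for every $\varepsilon>0$ there is $d_0$ such that for all $d\geq d_0$ there exist packings of unit-volume balls in $\mathbb{R}^d$ of density at least $(1-\varepsilon)\, d\log d/2^{d+1}$.
   Context: Let $r_d$ be the radius of the Euclidean ball of volume $1$ in $\mathbb{R}^d$. A sphere packing is a set $\mathcal P\subseteq\mathbb{R}^d$ with $\|x-y\|\geq 2r_d$ for all distinct $x,y\in\mathcal P$ (the centres of disjoint balls of volume $1$). The sphere packing density is \[ \theta(d)=\sup_{\mathcal P}\limsup_{R\to\infty}\frac{|\mathcal P\cap B_0(R)|}{\mathrm{Vol}(B_0(R))}, \] the supremum over all sphere packings, where $B_0(R)$ is the closed ball of radius $R$ about the origin. $\log$ denotes the natural logarithm. *)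

theory Defs
  imports "HOL-Analysis.Analysis"
begin

definition Rd :: "nat \<Rightarrow> (nat \<Rightarrow> real) set" where
  "Rd d = PiE {..<d} (\<lambda>_. UNIV)"

definition eucl_norm :: "nat \<Rightarrow> (nat \<Rightarrow> real) \<Rightarrow> real" where
  "eucl_norm d x = sqrt (\<Sum>i<d. (x i)\<^sup>2)"

definition vol :: "nat \<Rightarrow> (nat \<Rightarrow> real) set \<Rightarrow> real" where
  "vol d A = measure (Pi\<^sub>M {..<d} (\<lambda>_. lborel)) A"

definition ball0 :: "nat \<Rightarrow> real \<Rightarrow> (nat \<Rightarrow> real) set" where
  "ball0 d R = {x \<in> Rd d. eucl_norm d x \<le> R}"

definition r_d :: "nat \<Rightarrow> real" where
  "r_d d = (THE r. r > 0 \<and> vol d (ball0 d r) = 1)"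

definition sphere_packing :: "nat \<Rightarrow> (nat \<Rightarrow> real) set \<Rightarrow> bool" where
  "sphere_packing d P \<longleftrightarrow> P \<subseteq> Rd d \<and>
     (\<forall>x\<in>P. \<forall>y\<in>P. x \<noteq> y \<longrightarrow> eucl_norm d (x - y) \<ge> 2 * r_d d)"

definition upper_density :: "nat \<Rightarrow> (nat \<Rightarrow> real) set \<Rightarrow> ereal" where
  "upper_density d P =
     Limsup at_top (\<lambda>R::real. ereal (real (card (P \<inter> ball0 d R)) / vol d (ball0 d R)))"

definition theta :: "nat \<Rightarrow> ereal" where
  "theta d = (SUP P \<in> {P. sphere_packing d P}. upper_density d P)"

end

theory Submission
  imports Defs "HOL-Real_Asymp.Real_Asymp"
begin

text \<open>
  A packing is an independent set in the graph on the points of a fine grid in which points at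
  distance less than \<open>2 r\<close> are adjacent. If \<open>D\<close> is the maximum degree, then
  \<open>D\<close> times the cell volume is about \<open>2 ^ d\<close>, so it suffices to find an independent set containing a
  proportion \<open>(1 - o(1)) (d ln d / 2) / D\<close> of the points.

  Two grid points at distance at least \<open>r ln d / sqrt d\<close> have a common neighbourhood smaller than \<open>D\<close> by a
  superpolynomial factor in \<open>d\<close>, and only \<open>K\<close> points are closer than that to a given one, where
  \<open>ln (D / K)\<close> is about \<open>d ln d / 2\<close>. For such graphs the following nibble works: select each vertex with
  probability \<open>\<gamma> / D\<close>, keep the selected vertices without selected neighbours, and delete all
  neighbours of selected vertices. Survival events of pairwise far vertices are nearly independent, so
  high moments show that degrees and codegrees shrink by a factor \<open>1 - \<gamma>\<close>, except at a few bad vertices, which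
  are discarded. The relative degree and codegree bounds persist until the codegree bound reaches the
  size of \<open>K\<close>, i.e. for \<open>ln (D / K) / \<gamma>\<close> rounds up to lower order terms, and each round
  contributes a proportion \<open>\<gamma> / D\<close> of the original number of vertices.
\<close>

section \<open>Random subsets of a finite set\<close>

text \<open>Weight of \<open>A\<close> when every element of \<open>\<Omega>\<close> is picked
  independently with probability \<open>p\<close>. Probabilities and expectations are finite sums
  over \<open>Pow \<Omega>\<close>, which keeps measure theory out of the combinatorial
  half.\<close>

definition bern_wt :: "real \<Rightarrow> 'a set \<Rightarrow> 'a set \<Rightarrow> real" where
  "bern_wt p \<Omega> A = p ^ card A * (1 - p) ^ card (\<Omega> - A)"

lemma bern_wt_nonneg: "0 \<le> p \<Longrightarrow> p \<le> 1 \<Longrightarrow> 0 \<le> bern_wt p \<Omega> A"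
  by (simp add: bern_wt_def)

text \<open>Expand the product over \<open>\<Omega>\<close> of \<open>?f i + ?g i\<close>, where a
  subset \<open>A\<close> takes \<open>?f\<close> inside and \<open>?g\<close> outside. As
  \<open>?f\<close> vanishes on \<open>Y\<close> and \<open>?g\<close> on \<open>X\<close>, only the
  subsets meeting the condition contribute, and the factors outside \<open>X \<union> Y\<close>
  equal 1.\<close>

lemma bern_wt_prob:
  assumes fin: "finite \<Omega>" and X: "X \<subseteq> \<Omega>" and Y: "Y \<subseteq> \<Omega>" and XY: "X \<inter> Y = {}"
  shows "(\<Sum>A\<in>Pow \<Omega>. bern_wt p \<Omega> A * of_bool (X \<subseteq> A \<and> A \<inter> Y = {})) = p ^ card X * (1 - p) ^ card Y"
proof -
  let ?f = "\<lambda>i. if i \<in> Y then 0 else p" and ?g = "\<lambda>i. if i \<in> X then 0 else 1 - p"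
  have zero: "prod ?f A * prod ?g (\<Omega> - A) = bern_wt p \<Omega> A * of_bool (X \<subseteq> A \<and> A \<inter> Y = {})"
    if A: "A \<subseteq> \<Omega>" for A
  proof (cases "X \<subseteq> A \<and> A \<inter> Y = {}")
    case True
    have "prod ?f A = (\<Prod>i\<in>A. p)" using True by (intro prod.cong) auto
    moreover have "prod ?g (\<Omega> - A) = (\<Prod>i\<in>\<Omega> - A. 1 - p)" using True by (intro prod.cong) auto
    ultimately show ?thesis using True by (simp add: bern_wt_def)
  next
    case False
    have finA: "finite A" using A fin finite_subset by blast
    have "prod ?f A = 0 \<or> prod ?g (\<Omega> - A) = 0"
    proof (cases "A \<inter> Y = {}")
      case True
      then obtain x where "x \<in> X" "x \<notin> A" using False by blast
      then show ?thesis using X fin by (auto intro!: prod_zero)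
    next
      case False
      then show ?thesis using finA by (auto intro!: prod_zero)
    qed
    then show ?thesis using False by auto
  qed
  have "(\<Sum>A\<in>Pow \<Omega>. bern_wt p \<Omega> A * of_bool (X \<subseteq> A \<and> A \<inter> Y = {})) = (\<Prod>i\<in>\<Omega>. ?f i + ?g i)"
    unfolding prod_add[OF fin] by (intro sum.cong) (auto simp: zero)
  also have "\<dots> = (\<Prod>i\<in>X \<union> Y. ?f i + ?g i)"
    using X Y fin by (intro prod.mono_neutral_right) auto
  also have "\<dots> = (\<Prod>i\<in>X. ?f i + ?g i) * (\<Prod>i\<in>Y. ?f i + ?g i)"
    using XY X Y fin finite_subset by (intro prod.union_disjoint) auto
  also have "(\<Prod>i\<in>X. ?f i + ?g i) = (\<Prod>i\<in>X. p)" using XY by (intro prod.cong) auto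
  also have "(\<Prod>i\<in>Y. ?f i + ?g i) = (\<Prod>i\<in>Y. 1 - p)" using XY by (intro prod.cong) auto
  finally show ?thesis by simp
qed

lemma bern_wt_total: "finite \<Omega> \<Longrightarrow> (\<Sum>A\<in>Pow \<Omega>. bern_wt p \<Omega> A) = 1"
  using bern_wt_prob[of \<Omega> "{}" "{}" p] by simp

lemma bern_wt_expect_card:
  assumes "finite V"
  shows "(\<Sum>A\<in>Pow \<Omega>. bern_wt p \<Omega> A * real (card {v\<in>V. P v A})) =
    (\<Sum>v\<in>V. \<Sum>A\<in>Pow \<Omega>. bern_wt p \<Omega> A * of_bool (P v A))"
proof -
  have "real (card {v\<in>V. P v A}) = (\<Sum>v\<in>V. of_bool (P v A))" for A
    using assms by (simp add: sum.If_cases of_bool_def Int_def)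
  then show ?thesis
    by (simp add: sum_distrib_left) (rule sum.swap)
qed

section \<open>Lists of pairwise far vertices\<close>

text \<open>Ordered tuples instead of sets, so that they can be counted by prepending one entry at a
  time. When \<open>Q\<close> is reflexive, as in \<open>sparse_graph\<close>, the entries are
  automatically distinct.\<close>

definition far_lists :: "('a \<Rightarrow> 'a \<Rightarrow> bool) \<Rightarrow> 'a set \<Rightarrow> nat \<Rightarrow> 'a list set" where
  "far_lists Q S k = {xs. length xs = k \<and> set xs \<subseteq> S \<and> sorted_wrt (\<lambda>x y. \<not> Q x y) xs}"

lemma far_lists_subset: "far_lists Q S k \<subseteq> {xs. set xs \<subseteq> S \<and> length xs = k}"
  by (auto simp: far_lists_def)

lemma finite_far_lists: "finite S \<Longrightarrow> finite (far_lists Q S k)"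
  by (rule finite_subset[OF far_lists_subset finite_lists_length_eq])

lemma card_far_lists_le: "finite S \<Longrightarrow> card (far_lists Q S k) \<le> card S ^ k"
  using card_mono[OF finite_lists_length_eq far_lists_subset, of S Q k] by (simp add: card_lists_length_eq)

text \<open>Greedy count: a new first entry must avoid the at most \<open>K\<close> vertices close
  to each entry already present, which leaves at least \<open>y - n * K\<close> choices. The fixed
  \<open>n\<close> in place of the current length gives the same factor at every stage.\<close>

lemma card_far_lists_ge:
  fixes K y :: real
  assumes fin: "finite S" and close: "\<And>v. v \<in> S \<Longrightarrow> real (card {u\<in>S. Q u v}) \<le> K"
    and y: "y \<le> real (card S)" and K: "0 \<le> K" and pos: "0 \<le> y - n * K" and "k \<le> n"
  shows "(y - n * K) ^ k \<le> real (card (far_lists Q S k))"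
  using \<open>k \<le> n\<close>
proof (induction k)
  case 0
  have "far_lists Q S 0 = {[]}" by (auto simp: far_lists_def)
  then show ?case by simp
next
  case (Suc k)
  let ?B = "\<lambda>xs. {x\<in>S. \<forall>x'\<in>set xs. \<not> Q x x'}"
  have eq: "far_lists Q S (Suc k) = (\<lambda>(xs, x). x # xs) ` (SIGMA xs:far_lists Q S k. ?B xs)" (is "_ = ?R")
  proof (intro set_eqI iffI)
    fix ys assume "ys \<in> far_lists Q S (Suc k)"
    then show "ys \<in> ?R" by (cases ys) (auto simp: far_lists_def)
  qed (auto simp: far_lists_def)
  have inj: "inj_on (\<lambda>(xs, x). x # xs) (SIGMA xs:far_lists Q S k. ?B xs)"
    by (auto simp: inj_on_def)
  have B: "y - n * K \<le> real (card (?B xs))" if "xs \<in> far_lists Q S k" for xs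
  proof -
    have xs: "length xs = k" "set xs \<subseteq> S" using that by (auto simp: far_lists_def)
    have "S = ?B xs \<union> (\<Union>x'\<in>set xs. {u\<in>S. Q u x'})" by auto
    then have "card S = card (?B xs \<union> (\<Union>x'\<in>set xs. {u\<in>S. Q u x'}))"
      by (rule arg_cong)
    also have "\<dots> \<le> card (?B xs) + card (\<Union>x'\<in>set xs. {u\<in>S. Q u x'})"
      by (rule card_Un_le)
    finally have "card S \<le> card (?B xs) + card (\<Union>x'\<in>set xs. {u\<in>S. Q u x'})" .
    then have "real (card S) \<le> real (card (?B xs)) + real (card (\<Union>x'\<in>set xs. {u\<in>S. Q u x'}))"
      by linarith
    moreover have "card (\<Union>x'\<in>set xs. {u\<in>S. Q u x'}) \<le> (\<Sum>x'\<in>set xs. card {u\<in>S. Q u x'})"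
      by (rule card_UN_le) simp
    then have "real (card (\<Union>x'\<in>set xs. {u\<in>S. Q u x'})) \<le> (\<Sum>x'\<in>set xs. real (card {u\<in>S. Q u x'}))"
      unfolding of_nat_sum[symmetric] of_nat_le_iff .
    moreover have "(\<Sum>x'\<in>set xs. real (card {u\<in>S. Q u x'})) \<le> (\<Sum>x'\<in>set xs. K)"
      using xs close by (intro sum_mono) auto
    moreover have "real (card (set xs)) * K \<le> n * K"
      using xs Suc.prems card_length[of xs] K by (intro mult_right_mono) auto
    ultimately show ?thesis using y by simp
  qed
  have "real (card (far_lists Q S (Suc k))) = (\<Sum>xs\<in>far_lists Q S k. real (card (?B xs)))"
    unfolding eq card_image[OF inj] using fin finite_far_lists[OF fin] by (subst card_SigmaI) auto
  also have "\<dots> \<ge> (\<Sum>xs\<in>far_lists Q S k. y - n * K)"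
    using B by (intro sum_mono) auto
  also have "(\<Sum>xs\<in>far_lists Q S k. y - n * K) = real (card (far_lists Q S k)) * (y - n * K)" by simp
  also have "\<dots> \<ge> (y - n * K) ^ k * (y - n * K)"
    using Suc pos by (intro mult_right_mono) auto
  finally show ?case by (simp add: mult.commute)
qed

text \<open>Bonferroni: a prepended \<open>x\<close> overlaps the union of the other sets in at most
  \<open>length xs * C\<close> points, because all pairs are far. Summing these losses stays below
  the square of the length times \<open>C\<close>.\<close>

lemma card_UN_far_list_ge:
  fixes C :: real
  assumes fin: "\<And>v. v \<in> S \<Longrightarrow> finite (N v)" and m: "\<And>v. v \<in> S \<Longrightarrow> card (N v) = m"
    and cod: "\<And>u v. u \<in> S \<Longrightarrow> v \<in> S \<Longrightarrow> \<not> Q u v \<Longrightarrow> real (card (N u \<inter> N v)) \<le> C"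
    and xs: "set xs \<subseteq> S" "sorted_wrt (\<lambda>x y. \<not> Q x y) xs" and C: "0 \<le> C"
  shows "real (length xs) * m - (real (length xs))\<^sup>2 * C \<le> real (card (\<Union>x\<in>set xs. N x))"
  using xs
proof (induction xs)
  case (Cons x xs)
  let ?U = "\<Union>x\<in>set xs. N x" and ?l = "real (length xs)"
  have finU: "finite ?U" using Cons.prems fin by auto
  have finx: "finite (N x)" "card (N x) = m" using Cons.prems fin m by auto
  have "card (N x \<inter> ?U) \<le> (\<Sum>x'\<in>set xs. card (N x \<inter> N x'))"
    unfolding Int_UN_distrib by (rule card_UN_le) simp
  then have "real (card (N x \<inter> ?U)) \<le> (\<Sum>x'\<in>set xs. real (card (N x \<inter> N x')))"
    unfolding of_nat_sum[symmetric] of_nat_le_iff .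
  also have "\<dots> \<le> (\<Sum>x'\<in>set xs. C)" using Cons.prems cod by (intro sum_mono) auto
  also have "\<dots> \<le> ?l * C" using card_length[of xs] C by (simp add: mult_right_mono)
  finally have 1: "real (card (N x \<inter> ?U)) \<le> ?l * C" .
  have "card (N x) + card ?U = card (N x \<union> ?U) + card (N x \<inter> ?U)"
    by (rule card_Un_Int[OF finx(1) finU])
  then have "real (card (N x \<union> ?U)) = m + real (card ?U) - real (card (N x \<inter> ?U))"
    using finx by linarith
  moreover have "?l * m - ?l\<^sup>2 * C \<le> real (card ?U)" using Cons by simp
  moreover have "0 \<le> ?l * C" using C by simp
  ultimately show ?case using 1 C by (simp add: power2_eq_square algebra_simps)
qed simp

text \<open>Markov's inequality for the number of far lists of length \<open>k\<close> among the survivors: the events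
  that different vertices survive are almost independent as soon as the vertices are pairwise far.\<close>

lemma survivors_tail:
  fixes p y M K C :: real
  assumes fin\<Omega>: "finite \<Omega>" and finS: "finite S" and N: "\<And>v. v \<in> S \<Longrightarrow> N v \<subseteq> \<Omega>"
    and m: "\<And>v. v \<in> S \<Longrightarrow> card (N v) = m"
    and cod: "\<And>u v. u \<in> S \<Longrightarrow> v \<in> S \<Longrightarrow> \<not> Q u v \<Longrightarrow> real (card (N u \<inter> N v)) \<le> C"
    and close: "\<And>v. v \<in> S \<Longrightarrow> real (card {u\<in>S. Q u v}) \<le> K"
    and SM: "real (card S) \<le> M" and C: "0 \<le> C" and K: "0 \<le> K" and y: "0 < y - k * K"
    and p: "0 \<le> p" "p \<le> 1"
  shows "(\<Sum>A\<in>Pow \<Omega>. bern_wt p \<Omega> A * of_bool (y < real (card {v\<in>S. A \<inter> N v = {}})))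
     \<le> (M / (y - k * K)) ^ k * exp (- p * (real k * m - (real k)\<^sup>2 * C))"
proof -
  let ?Y = "\<lambda>A. {v\<in>S. A \<inter> N v = {}}" and ?z = "y - k * K"
  let ?F = "far_lists Q S k"
  have finF: "finite ?F" by (rule finite_far_lists[OF finS])
  \<comment> \<open>This turns the number of far lists of survivors into a sum over fixed lists of
    \<open>S\<close>, each with an explicit survival probability.\<close>
  have F_eq: "far_lists Q (?Y A) k = {xs\<in>?F. A \<inter> (\<Union>x\<in>set xs. N x) = {}}" for A
    by (auto simp: far_lists_def)
  \<comment> \<open>More than \<open>y\<close> survivors contain at least \<open>?z ^ k\<close> far
    lists, so the indicator is dominated by the normalised count. This is the pointwise form of
    Markov's inequality.\<close>
  have mk: "of_bool (y < real (card (?Y A))) \<le> real (card (far_lists Q (?Y A) k)) / ?z ^ k" for A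
  proof (cases "y < real (card (?Y A))")
    case True
    have "?z ^ k \<le> real (card (far_lists Q (?Y A) k))"
    proof (rule card_far_lists_ge)
      fix v assume "v \<in> ?Y A"
      moreover have "card {u \<in> ?Y A. Q u v} \<le> card {u\<in>S. Q u v}"
        using finS by (intro card_mono) auto
      ultimately show "real (card {u \<in> ?Y A. Q u v}) \<le> K" using close[of v] by simp
    qed (use finS True K y in auto)
    then show ?thesis using y True by simp
  qed (use y in auto)
  have "(\<Sum>A\<in>Pow \<Omega>. bern_wt p \<Omega> A * of_bool (y < real (card (?Y A))))
      \<le> (\<Sum>A\<in>Pow \<Omega>. bern_wt p \<Omega> A * (real (card (far_lists Q (?Y A) k)) / ?z ^ k))"
    using mk bern_wt_nonneg[OF p] by (intro sum_mono mult_left_mono) auto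
  also have "\<dots> = (\<Sum>A\<in>Pow \<Omega>. bern_wt p \<Omega> A * real (card (far_lists Q (?Y A) k))) / ?z ^ k"
    by (simp add: sum_divide_distrib)
  also have "(\<Sum>A\<in>Pow \<Omega>. bern_wt p \<Omega> A * real (card (far_lists Q (?Y A) k)))
      = (\<Sum>xs\<in>?F. \<Sum>A\<in>Pow \<Omega>. bern_wt p \<Omega> A * of_bool (A \<inter> (\<Union>x\<in>set xs. N x) = {}))"
    unfolding F_eq by (rule bern_wt_expect_card[OF finF])
  also have "\<dots> \<le> (\<Sum>xs\<in>?F. exp (- p * (real k * m - (real k)\<^sup>2 * C)))"
  proof (rule sum_mono)
    fix xs assume xs: "xs \<in> ?F"
    let ?U = "\<Union>x\<in>set xs. N x"
    have "?U \<subseteq> \<Omega>" using xs N by (auto simp: far_lists_def)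
    then have "(\<Sum>A\<in>Pow \<Omega>. bern_wt p \<Omega> A * of_bool (A \<inter> ?U = {})) = (1 - p) ^ card ?U"
      using bern_wt_prob[OF fin\<Omega>, of "{}" ?U p] by simp
    also have "\<dots> \<le> exp (- p) ^ card ?U"
      using exp_ge_add_one_self[of "- p"] p by (intro power_mono) auto
    also have "\<dots> = exp (- p * card ?U)" by (simp add: exp_of_nat_mult[symmetric] mult.commute)
    also have "\<dots> \<le> exp (- p * (real k * m - (real k)\<^sup>2 * C))"
    proof -
      have "real (length xs) * m - (real (length xs))\<^sup>2 * C \<le> real (card ?U)"
        using xs N finite_subset[OF N fin\<Omega>] m cod C
        by (intro card_UN_far_list_ge[of S N m Q C xs]) (auto simp: far_lists_def)
      moreover have "length xs = k" using xs by (simp add: far_lists_def)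
      ultimately show ?thesis using p by (simp add: mult_left_mono)
    qed
    finally show "(\<Sum>A\<in>Pow \<Omega>. bern_wt p \<Omega> A * of_bool (A \<inter> ?U = {}))
      \<le> exp (- p * (real k * m - (real k)\<^sup>2 * C))" .
  qed
  also have "\<dots> = real (card ?F) * exp (- p * (real k * m - (real k)\<^sup>2 * C))" by simp
  also have "\<dots> \<le> M ^ k * exp (- p * (real k * m - (real k)\<^sup>2 * C))"
  proof (rule mult_right_mono)
    have "real (card ?F) \<le> real (card S) ^ k"
      using card_far_lists_le[OF finS, of Q k] by (simp flip: of_nat_power)
    also have "\<dots> \<le> M ^ k" using SM by (intro power_mono) auto
    finally show "real (card ?F) \<le> M ^ k" .
  qed simp
  finally show ?thesis using y by (simp add: divide_right_mono power_divide)
qed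

section \<open>The nibble\<close>

definition indep :: "('a \<Rightarrow> 'a \<Rightarrow> bool) \<Rightarrow> 'a set \<Rightarrow> bool" where
  "indep E I \<longleftrightarrow> (\<forall>x\<in>I. \<forall>y\<in>I. \<not> E x y)"

definition indep_num :: "('a \<Rightarrow> 'a \<Rightarrow> bool) \<Rightarrow> 'a set \<Rightarrow> nat" where
  "indep_num E V = Max (card ` {I. I \<subseteq> V \<and> indep E I})"

lemma indep_num_ge:
  assumes "finite V" "I \<subseteq> V" "indep E I"
  shows "card I \<le> indep_num E V"
  unfolding indep_num_def using assms by (intro Max_ge) auto

lemma indep_num_attained:
  assumes "finite V"
  obtains I where "I \<subseteq> V" "indep E I" "card I = indep_num E V"
proof -
  have "indep_num E V \<in> card ` {I. I \<subseteq> V \<and> indep E I}"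
    unfolding indep_num_def
  proof (rule Max_in)
    have "{} \<in> {I. I \<subseteq> V \<and> indep E I}" by (simp add: indep_def)
    then show "card ` {I. I \<subseteq> V \<and> indep E I} \<noteq> {}" by blast
  qed (use assms in auto)
  then show ?thesis using that by auto
qed

text \<open>The relation \<open>Q\<close> says that two vertices are close. Close pairs are exempt from the codegree
  bound \<open>C\<close>, but a vertex has at most \<open>K\<close> of them.\<close>

definition sparse_graph ::
  "('a \<Rightarrow> 'a \<Rightarrow> bool) \<Rightarrow> ('a \<Rightarrow> 'a \<Rightarrow> bool) \<Rightarrow> 'a set \<Rightarrow> real \<Rightarrow> real \<Rightarrow> real \<Rightarrow> bool" where
  "sparse_graph E Q V D C K \<longleftrightarrow> finite V \<and>
     (\<forall>u\<in>V. \<not> E u u \<and> Q u u) \<and> (\<forall>u\<in>V. \<forall>v\<in>V. E u v \<longrightarrow> E v u) \<and>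
     (\<forall>v\<in>V. real (card {u\<in>V. E v u}) \<le> D) \<and>
     (\<forall>u\<in>V. \<forall>v\<in>V. \<not> Q u v \<longrightarrow> real (card {w\<in>V. E u w \<and> E v w}) \<le> C) \<and>
     (\<forall>v\<in>V. real (card {u\<in>V. Q u v}) \<le> K)"

text \<open>The product of \<open>1 + x + x^2/2\<close> and \<open>1 - x + x^2/2\<close> is
  \<open>1 + x^4/4\<close>, hence at least 1, and \<open>exp x\<close> is at least the first
  factor.\<close>

lemma exp_minus_le_quadratic:
  fixes x :: real
  assumes "0 \<le> x"
  shows "exp (- x) \<le> 1 - x + x\<^sup>2 / 2"
proof -
  have "0 \<le> 1 - x + x\<^sup>2 / 2"
    using zero_le_power2[of "x - 1"] by (simp add: power2_eq_square algebra_simps)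
  then have "(1 + x + x\<^sup>2 / 2) * (1 - x + x\<^sup>2 / 2) \<le> exp x * (1 - x + x\<^sup>2 / 2)"
    using exp_lower_Taylor_quadratic[OF assms] by (intro mult_right_mono) auto
  moreover have "(1 + x + x\<^sup>2 / 2) * (1 - x + x\<^sup>2 / 2) = 1 + (x\<^sup>2)\<^sup>2 / 4"
    by (simp add: power2_eq_square field_simps)
  ultimately have "1 \<le> exp x * (1 - x + x\<^sup>2 / 2)" using zero_le_power2[of "x\<^sup>2"] by linarith
  then show ?thesis by (simp add: exp_minus inverse_eq_divide pos_divide_le_eq mult.commute)
qed

text \<open>Accounting per list entry: the ratio of the survival factor
  \<open>exp (- \<gamma>)\<close> to the threshold \<open>?t\<close> is at most
  \<open>exp (- (\<delta> / 2))\<close>, because the quadratic error is at most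
  \<open>\<delta> / 4\<close>. Overlaps of the killer sets cost at most
  \<open>exp (\<delta> / 4)\<close>, so \<open>exp (- (\<delta> / 4))\<close> remains, and there are
  \<open>k\<close> entries.\<close>

lemma nibble_step_tail_bound:
  fixes \<gamma> \<delta> M K C y :: real and k m :: nat
  assumes "0 < \<gamma>" "\<gamma> \<le> 1/4" "0 < \<delta>" "\<delta> \<le> \<gamma>" "\<gamma>\<^sup>2 \<le> \<delta> / 2"
    and M: "0 < M" and y: "(1 - \<gamma> + \<delta>) * M - k * K \<ge> (1 - \<gamma> + 3/4 * \<delta>) * M"
    and m: "0 < m" and C: "4 * \<gamma> * k * C \<le> \<delta> * m"
  shows "(M / ((1 - \<gamma> + \<delta>) * M - k * K)) ^ k * exp (- (\<gamma> / m) * (real k * m - (real k)\<^sup>2 * C))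
    \<le> exp (- (k * \<delta> / 4))"
proof -
  let ?t = "1 - \<gamma> + 3/4 * \<delta>" and ?z = "(1 - \<gamma> + \<delta>) * M - k * K"
  have t: "0 < ?t" "?t \<le> 1" using assms by auto
  have tM: "0 < ?t * M" using t M by simp
  have z: "0 < ?z" using tM y by linarith
  have "M / ?z \<le> M / (?t * M)" using M by (intro divide_left_mono[OF y] mult_pos_pos[OF z tM]) simp
  also have "\<dots> = 1 / ?t" using M by simp
  finally have 1: "(M / ?z) ^ k \<le> (1 / ?t) ^ k"
    using z M by (intro power_mono divide_nonneg_nonneg) auto
  have "- (\<gamma> / m) * (real k * m - (real k)\<^sup>2 * C) = k * (- \<gamma>) + k * (\<gamma> * k * C / m)"
    using m by (simp add: field_simps power2_eq_square)
  also have "\<gamma> * k * C / m \<le> \<delta> / 4" using C m by (simp add: field_simps)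
  finally have e: "- (\<gamma> / m) * (real k * m - (real k)\<^sup>2 * C) \<le> k * (- \<gamma>) + k * (\<delta> / 4)"
    by (simp add: mult_left_mono)
  have "exp (- \<gamma>) \<le> 1 - \<gamma> + \<gamma>\<^sup>2 / 2"
    using \<open>0 < \<gamma>\<close> by (intro exp_minus_le_quadratic) simp
  then have "exp (- \<gamma>) \<le> ?t - \<delta> / 2" using assms by simp
  also have "\<dots> \<le> ?t * (1 - \<delta> / 2)"
  proof -
    have "?t * (\<delta> / 2) \<le> 1 * (\<delta> / 2)" using assms by (intro mult_right_mono[OF t(2)]) simp
    moreover have "?t * (1 - \<delta> / 2) = ?t - ?t * (\<delta> / 2)" by (simp only: right_diff_distrib mult_1_right)
    ultimately show ?thesis by linarith
  qed
  also have "\<dots> \<le> ?t * exp (- (\<delta> / 2))"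
    using exp_ge_add_one_self[of "- (\<delta> / 2)"] t by (intro mult_left_mono) auto
  finally have "exp (- \<gamma>) / ?t \<le> exp (- (\<delta> / 2))" using t by (simp add: field_simps)
  then have 2: "(exp (- \<gamma>) / ?t) ^ k \<le> exp (- (\<delta> / 2)) ^ k" using t by (intro power_mono) auto
  have "(M / ?z) ^ k * exp (- (\<gamma> / m) * (real k * m - (real k)\<^sup>2 * C))
      \<le> (1 / ?t) ^ k * exp (k * (- \<gamma>) + k * (\<delta> / 4))"
    using 1 e t by (intro mult_mono) auto
  also have "\<dots> = (exp (- \<gamma>) / ?t) ^ k * exp (k * (\<delta> / 4))"
    by (simp only: exp_add exp_of_nat_mult power_divide power_one times_divide_eq_left times_divide_eq_right
      mult_1_left mult.assoc)
  also have "\<dots> \<le> exp (- (\<delta> / 2)) ^ k * exp (k * (\<delta> / 4))"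
    using 2 by (intro mult_right_mono) auto
  also have "\<dots> = exp (- (k * \<delta> / 4))"
    by (simp add: exp_of_nat_mult[symmetric] exp_add[symmetric])
  finally show ?thesis .
qed

text \<open>Every vertex is given private dummy neighbours so that all of them have exactly
  \<open>m = \<lfloor>D\<rfloor>\<close> potential killers and hence the same survival probability.
  Adding the expected size of the selected set to \<open>c\<close> times the expected number of survivors avoids
  having to make both random variables large simultaneously.\<close>

lemma nibble_step:
  fixes \<gamma> \<delta> D C K c N :: real and k :: nat
  assumes G: "sparse_graph E Q V D C K" and N: "real (card V) \<le> N"
    and \<gamma>: "0 < \<gamma>" "\<gamma> \<le> 1/4" and \<delta>: "0 < \<delta>" "\<delta> \<le> \<gamma>" "\<gamma>\<^sup>2 \<le> \<delta> / 2"
    and K: "0 \<le> K" "k * K \<le> \<delta> * C / 4" and C: "0 < C" "8 * \<gamma> * k * C \<le> \<delta> * D" "C \<le> D"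
    and D: "1 \<le> D" "2 * \<gamma> \<le> \<delta> * D"
    and k: "(1 + N) * exp (- (k * \<delta> / 4)) \<le> \<delta>"
    and c: "0 \<le> c"
    and IH: "\<And>V'. V' \<subseteq> V \<Longrightarrow> sparse_graph E Q V' ((1 - \<gamma> + \<delta>) * D) ((1 - \<gamma> + \<delta>) * C) K \<Longrightarrow>
      c * real (card V') \<le> real (indep_num E V')"
  shows "(\<gamma> * (1 - \<gamma>) / D + c * (1 - \<gamma> - 2 * \<delta>)) * real (card V) \<le> real (indep_num E V)"
proof -
  define m where "m = nat \<lfloor>D\<rfloor>"
  \<comment> \<open>Dividing by \<open>m\<close> and not by \<open>D\<close> makes the expected
    number of selected killers of a vertex exactly \<open>\<gamma>\<close>.\<close>
  define p where "p = \<gamma> / m"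
  let ?th = "1 - \<gamma> + \<delta>"
  have finV: "finite V" using G by (simp add: sparse_graph_def)
  have m: "1 \<le> m" "real m \<le> D" "D \<le> 2 * m"
  proof -
    show "1 \<le> m" "real m \<le> D" using D unfolding m_def by linarith+
    moreover have "D < real m + 1" using D unfolding m_def by linarith
    ultimately show "D \<le> 2 * m" by linarith
  qed
  have p: "0 < p" "p \<le> 1" "p \<le> \<delta>" "p * m = \<gamma>" "\<gamma> / D \<le> p"
  proof -
    show "0 < p" "p * m = \<gamma>" using m \<gamma> by (auto simp: p_def)
    have "2 * \<gamma> \<le> \<delta> * (2 * m)" using D m \<delta> by (meson mult_left_mono order_trans less_imp_le)
    then show "p \<le> \<delta>" using m by (simp add: p_def field_simps)
    then show "p \<le> 1" using \<delta> \<gamma> by linarith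
    show "\<gamma> / D \<le> p" unfolding p_def using m \<gamma> D by (intro divide_left_mono mult_pos_pos) auto
  qed
  define nb where "nb v = {u\<in>V. E v u}" for v
  have nb: "finite (nb v)" "nb v \<subseteq> V" "v \<notin> nb v" if "v \<in> V" for v
    using finV G that by (auto simp: nb_def sparse_graph_def)
  have nbm: "card (nb v) \<le> m" if "v \<in> V" for v
  proof -
    have "real (card (nb v)) \<le> D" using G that by (simp add: nb_def sparse_graph_def)
    then show ?thesis unfolding m_def by linarith
  qed
  define \<Omega> :: "('a + 'a \<times> nat) set" where "\<Omega> = Inl ` V \<union> Inr ` (V \<times> {..<m})"
  define ks :: "'a \<Rightarrow> ('a + 'a \<times> nat) set"
    where "ks v = Inl ` nb v \<union> Inr ` ({v} \<times> {..<m - card (nb v)})" for v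
  have fin\<Omega>: "finite \<Omega>" using finV by (simp add: \<Omega>_def)
  have ks\<Omega>: "ks v \<subseteq> \<Omega>" "Inl v \<in> \<Omega>" "Inl v \<notin> ks v" if "v \<in> V" for v
    using that nb[OF that] by (auto simp: ks_def \<Omega>_def)
  have ksm: "card (ks v) = m" if "v \<in> V" for v
  proof -
    have "card (ks v) = card (nb v) + (m - card (nb v))"
      unfolding ks_def using nb[OF that] by (subst card_Un_disjoint) (auto simp: card_image)
    then show ?thesis using nbm[OF that] by simp
  qed
  \<comment> \<open>The dummies of different vertices are different, so they do not add to
    codegrees.\<close>
  have kscod: "real (card (ks u \<inter> ks v)) \<le> C" if "u \<in> V" "v \<in> V" "\<not> Q u v" for u v
  proof -
    have "u \<noteq> v" using that G by (auto simp: sparse_graph_def)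
    then have "ks u \<inter> ks v = Inl ` {w\<in>V. E u w \<and> E v w}" by (auto simp: ks_def nb_def)
    then show ?thesis using that G by (simp add: card_image sparse_graph_def)
  qed
  \<comment> \<open>Dummies never prevent a selection, so \<open>Sel\<close> looks at real
    neighbours only. \<open>Y\<close> depends only on the killers and is the set to which the tail
    bound applies. \<open>W\<close> also drops the vertices that were picked themselves; the next
    round takes place inside \<open>W\<close>, and bounds for \<open>Y\<close> carry over since
    \<open>W\<close> is a subset of it.\<close>
  define Sel where "Sel A = {v\<in>V. Inl v \<in> A \<and> A \<inter> Inl ` nb v = {}}" for A :: "('a + 'a \<times> nat) set"
  define Y where "Y A = {v\<in>V. A \<inter> ks v = {}}" for A
  define W where "W A = {v\<in>V. A \<inter> insert (Inl v) (ks v) = {}}" for A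
  define bad where "bad A = {v\<in>V. ?th * D < card (nb v \<inter> Y A) \<or>
      (\<exists>u\<in>V. \<not> Q u v \<and> ?th * C < card (nb u \<inter> nb v \<inter> Y A))}" for A
  define P where "P F = (\<Sum>A\<in>Pow \<Omega>. bern_wt p \<Omega> A * F A)" for F :: "_ \<Rightarrow> real"
  have wt: "0 \<le> bern_wt p \<Omega> A" for A using p by (intro bern_wt_nonneg) auto
  have P_mono: "P F \<le> P F'" if "\<And>A. A \<subseteq> \<Omega> \<Longrightarrow> F A \<le> F' A" for F F'
    unfolding P_def using that wt by (intro sum_mono mult_left_mono) auto

  \<comment> \<open>This holds for every outcome \<open>A\<close>: the vertices of
    \<open>W A\<close> that are not bad satisfy \<open>IH\<close> and have no neighbour in
    \<open>Sel A\<close>, so an independent set among them can be added to \<open>Sel A\<close>. The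
    bound is linear in the three cardinalities, so their expectations suffice.\<close>
  have step: "card (Sel A) + c * (real (card (W A)) - card (bad A)) \<le> real (indep_num E V)" for A
  proof -
    define V' where "V' = W A - bad A"
    have sub: "V' \<subseteq> V" "V' \<subseteq> Y A" "V' \<inter> bad A = {}" by (auto simp: V'_def W_def Y_def)
    have finV': "finite V'" using sub finV finite_subset by blast
    have "sparse_graph E Q V' (?th * D) (?th * C) K"
      unfolding sparse_graph_def
    proof (intro conjI ballI impI)
      fix v assume v: "v \<in> V'"
      then have vV: "v \<in> V" "v \<notin> bad A" using sub by auto
      have "card {u\<in>V'. E v u} \<le> card (nb v \<inter> Y A)"
        using sub nb[OF vV(1)] by (intro card_mono) (auto simp: nb_def)
      moreover have "card (nb v \<inter> Y A) \<le> ?th * D" using vV unfolding bad_def by auto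
      ultimately show "real (card {u\<in>V'. E v u}) \<le> ?th * D" by linarith
      have "card {u\<in>V'. Q u v} \<le> card {u\<in>V. Q u v}"
        using sub finV by (intro card_mono) auto
      moreover have "real (card {u\<in>V. Q u v}) \<le> K" using vV G by (simp add: sparse_graph_def)
      ultimately show "real (card {u\<in>V'. Q u v}) \<le> K" by linarith
    next
      fix u v assume uv: "u \<in> V'" "v \<in> V'" "\<not> Q u v"
      then have vV: "u \<in> V" "v \<in> V" "v \<notin> bad A" using sub by auto
      have "card {w\<in>V'. E u w \<and> E v w} \<le> card (nb u \<inter> nb v \<inter> Y A)"
        using sub nb[OF vV(1)] by (intro card_mono) (auto simp: nb_def)
      moreover have "card (nb u \<inter> nb v \<inter> Y A) \<le> ?th * C"
      proof (rule ccontr)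
        assume "\<not> card (nb u \<inter> nb v \<inter> Y A) \<le> ?th * C"
        then have "v \<in> bad A" unfolding bad_def using vV uv(3) by (intro CollectI conjI disjI2 bexI[of _ u]) auto
        then show False using vV by simp
      qed
      ultimately show "real (card {w\<in>V'. E u w \<and> E v w}) \<le> ?th * C" by linarith
    next
      fix u assume "u \<in> V'"
      then have "u \<in> V" using sub by blast
      then show "\<not> E u u" "Q u u" using G by (simp_all add: sparse_graph_def)
    next
      fix u v assume "u \<in> V'" "v \<in> V'" "E u v"
      then show "E v u" using G sub(1) by (simp add: sparse_graph_def subset_iff)
    qed (rule finV')
    then have "c * real (card V') \<le> real (indep_num E V')" by (rule IH[OF sub(1)])
    moreover have "real (card (W A)) - card (bad A) \<le> card V'"
    proof -
      have "finite (bad A)" using finV by (simp add: bad_def)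
      then have "card (W A) - card (bad A) \<le> card V'" unfolding V'_def by (rule diff_card_le_card_Diff)
      then show ?thesis by linarith
    qed
    then have "c * (real (card (W A)) - card (bad A)) \<le> c * card V'"
      using c by (intro mult_left_mono) auto
    moreover obtain I where I: "I \<subseteq> V'" "indep E I" "card I = indep_num E V'"
      using indep_num_attained[OF finV'] by blast
    have finI: "finite I" using I finV' finite_subset by blast
    have Wnb: "\<not> E v u \<and> v \<noteq> u" if "v \<in> W A" "u \<in> Sel A" for u v
      using that by (auto simp: W_def Sel_def ks_def nb_def)
    have Wnb': "\<not> E u v" if "v \<in> W A" "u \<in> Sel A" for u v
      using Wnb[OF that] that G by (auto simp: W_def Sel_def sparse_graph_def)
    have IW: "I \<subseteq> W A" using I by (auto simp: V'_def)
    have "indep E (Sel A \<union> I)"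
      unfolding indep_def
    proof (intro ballI)
      fix x y assume "x \<in> Sel A \<union> I" "y \<in> Sel A \<union> I"
      moreover have "\<not> E x y" if "x \<in> Sel A" "y \<in> Sel A"
        using that by (auto simp: Sel_def nb_def)
      moreover have "\<not> E x y" if "x \<in> I" "y \<in> I"
        using that I(2) by (simp add: indep_def)
      moreover have "\<not> E x y" if "x \<in> I" "y \<in> Sel A" using Wnb IW that by auto
      moreover have "\<not> E x y" if "x \<in> Sel A" "y \<in> I" using Wnb' IW that by auto
      ultimately show "\<not> E x y" by (elim UnE) simp_all
    qed
    then have "card (Sel A \<union> I) \<le> indep_num E V"
      using sub I finV by (intro indep_num_ge) (auto simp: Sel_def)
    moreover have "card (Sel A \<union> I) = card (Sel A) + card I"
      using finI finV IW Wnb by (intro card_Un_disjoint) (auto simp: Sel_def)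
    ultimately show ?thesis using I by linarith
  qed

  have bern: "1 - x * real n \<le> (1 - x) ^ n" if "0 \<le> x" "x \<le> 1" for x :: real and n
    using Bernoulli_inequality[of "- x" n] that by (simp add: mult.commute)
  \<comment> \<open>A picked vertex is kept unless one of its at most \<open>m\<close> real
    neighbours is picked as well; Bernoulli's inequality bounds that loss by
    \<open>p * m = \<gamma>\<close>.\<close>
  have ESel: "\<gamma> * (1 - \<gamma>) / D * card V \<le> P (\<lambda>A. card (Sel A))"
  proof -
    have "P (\<lambda>A. card (Sel A)) =
        (\<Sum>v\<in>V. \<Sum>A\<in>Pow \<Omega>. bern_wt p \<Omega> A * of_bool ({Inl v} \<subseteq> A \<and> A \<inter> Inl ` nb v = {}))"
      unfolding P_def Sel_def by (subst bern_wt_expect_card[OF finV]) simp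
    also have "\<dots> = (\<Sum>v\<in>V. p * (1 - p) ^ card (nb v))"
    proof (intro sum.cong refl)
      fix v assume v: "v \<in> V"
      have "Inl ` nb v \<subseteq> \<Omega>" using ks\<Omega>(1)[OF v] by (auto simp: ks_def)
      then show "(\<Sum>A\<in>Pow \<Omega>. bern_wt p \<Omega> A * of_bool ({Inl v} \<subseteq> A \<and> A \<inter> Inl ` nb v = {}))
          = p * (1 - p) ^ card (nb v)"
        using fin\<Omega> ks\<Omega>[OF v] nb[OF v] by (subst bern_wt_prob) (auto simp: card_image)
    qed
    also have "\<dots> \<ge> (\<Sum>v\<in>V. \<gamma> * (1 - \<gamma>) / D)"
    proof (rule sum_mono)
      fix v assume v: "v \<in> V"
      have "p * real (card (nb v)) \<le> p * m" using nbm[OF v] p by (intro mult_left_mono) auto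
      then have "1 - \<gamma> \<le> (1 - p) ^ card (nb v)" using bern[of p "card (nb v)"] p by simp
      then have "(\<gamma> / D) * (1 - \<gamma>) \<le> p * (1 - p) ^ card (nb v)"
        using p \<gamma> by (intro mult_mono) auto
      then show "\<gamma> * (1 - \<gamma>) / D \<le> p * (1 - p) ^ card (nb v)" by simp
    qed
    finally show ?thesis by (simp add: mult.commute)
  qed
  \<comment> \<open>The exponent is \<open>m + 1\<close> because the vertex itself must be unpicked
    too; this extra factor costs at most \<open>p \<le> \<delta>\<close>.\<close>
  have EW: "(1 - \<gamma> - \<delta>) * card V \<le> P (\<lambda>A. card (W A))"
  proof -
    have "P (\<lambda>A. card (W A)) = (\<Sum>v\<in>V. \<Sum>A\<in>Pow \<Omega>. bern_wt p \<Omega> A *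
        of_bool ({} \<subseteq> A \<and> A \<inter> insert (Inl v) (ks v) = {}))"
      unfolding P_def W_def by (subst bern_wt_expect_card[OF finV]) simp
    also have "\<dots> = (\<Sum>v\<in>V. (1 - p) ^ (m + 1))"
    proof (intro sum.cong refl)
      fix v assume v: "v \<in> V"
      have "card (insert (Inl v) (ks v)) = m + 1"
        using ks\<Omega>[OF v] ksm[OF v] finite_subset[OF ks\<Omega>(1)[OF v] fin\<Omega>] by simp
      then show "(\<Sum>A\<in>Pow \<Omega>. bern_wt p \<Omega> A * of_bool ({} \<subseteq> A \<and> A \<inter> insert (Inl v) (ks v) = {}))
          = (1 - p) ^ (m + 1)"
        using fin\<Omega> ks\<Omega>[OF v] by (subst bern_wt_prob) auto
    qed
    also have "\<dots> = (1 - p) ^ (m + 1) * card V" by simp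
    also have "\<dots> \<ge> (1 - \<gamma> - \<delta>) * card V"
    proof (rule mult_right_mono)
      have "1 - p * (m + 1) \<le> (1 - p) ^ (m + 1)" using bern[of p "m + 1"] p by simp
      then show "1 - \<gamma> - \<delta> \<le> (1 - p) ^ (m + 1)" using p by (simp add: algebra_simps)
    qed simp
    finally show ?thesis .
  qed
  \<comment> \<open>Used with \<open>M = D\<close> for neighbourhoods and with \<open>M = C\<close>
    for common neighbourhoods. The condition \<open>C \<le> M\<close> keeps the excluded close
    vertices, at most \<open>k * K\<close>, below \<open>\<delta> * M / 4\<close>.\<close>
  have tail: "P (\<lambda>A. of_bool (?th * M < card (S \<inter> Y A))) \<le> exp (- (k * \<delta> / 4))"
    if S: "S \<subseteq> V" "real (card S) \<le> M" and M: "C \<le> M" for S M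
  proof -
    have eq: "S \<inter> Y A = {v\<in>S. A \<inter> ks v = {}}" for A using S by (auto simp: Y_def)
    have "k * K \<le> \<delta> * M / 4" using K mult_left_mono[OF M, of \<delta>] \<delta> by linarith
    then have y: "(1 - \<gamma> + 3/4 * \<delta>) * M \<le> ?th * M - k * K" by (simp add: algebra_simps)
    have M0: "0 < M" using M C by simp
    have "0 < (1 - \<gamma> + 3/4 * \<delta>) * M" using M0 \<gamma> \<delta> by (intro mult_pos_pos) auto
    then have "P (\<lambda>A. of_bool (?th * M < card (S \<inter> Y A)))
      \<le> (M / (?th * M - k * K)) ^ k * exp (- p * (real k * m - (real k)\<^sup>2 * C))"
      unfolding P_def eq
    proof (intro survivors_tail[where Q = Q])
      fix v assume v: "v \<in> S"
      have "card {u\<in>S. Q u v} \<le> card {u\<in>V. Q u v}"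
        using S finV by (intro card_mono) auto
      moreover have "real (card {u\<in>V. Q u v}) \<le> K" using v S G by (auto simp: sparse_graph_def)
      ultimately show "real (card {u\<in>S. Q u v}) \<le> K" by linarith
      have vV: "v \<in> V" using v S by blast
      show "ks v \<subseteq> \<Omega>" "card (ks v) = m" by (rule ks\<Omega>(1)[OF vV], rule ksm[OF vV])
      fix u assume "u \<in> S" "\<not> Q u v"
      then show "real (card (ks u \<inter> ks v)) \<le> C" using S(1) by (intro kscod vV) auto
    qed (use fin\<Omega> finite_subset[OF S(1) finV] S(2) K(1) C(1) p(1,2) y in auto)
    also have "\<dots> \<le> exp (- (k * \<delta> / 4))"
      unfolding p_def
    proof (rule nibble_step_tail_bound[OF \<gamma> \<delta> M0 y])
      have "\<delta> * D \<le> \<delta> * (2 * m)" using m \<delta> by (intro mult_left_mono) auto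
      then show "4 * \<gamma> * k * C \<le> \<delta> * m" using C by simp
    qed (use m in auto)
    finally show ?thesis .
  qed
  \<comment> \<open>Union bound over the degree event and one codegree event for each far vertex, at
    most \<open>1 + N\<close> events in all; \<open>k\<close> was chosen large enough to pay for
    them.\<close>
  have Ebad: "P (\<lambda>A. card (bad A)) \<le> \<delta> * card V"
  proof -
    let ?e = "exp (- (k * \<delta> / 4))"
    have "P (\<lambda>A. card (bad A)) = (\<Sum>v\<in>V. P (\<lambda>A. of_bool (?th * D < card (nb v \<inter> Y A) \<or>
      (\<exists>u\<in>V. \<not> Q u v \<and> ?th * C < card (nb u \<inter> nb v \<inter> Y A)))))"
      unfolding P_def bad_def by (rule bern_wt_expect_card[OF finV])
    also have "\<dots> \<le> (\<Sum>v\<in>V. \<delta>)"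
    proof (rule sum_mono)
      fix v assume v: "v \<in> V"
      let ?U = "{u\<in>V. \<not> Q u v}"
      let ?f = "\<lambda>A. of_bool (?th * D < card (nb v \<inter> Y A)) :: real"
      let ?g = "\<lambda>u A. of_bool (?th * C < card (nb u \<inter> nb v \<inter> Y A)) :: real"
      have "P (\<lambda>A. of_bool (?th * D < card (nb v \<inter> Y A) \<or>
          (\<exists>u\<in>V. \<not> Q u v \<and> ?th * C < card (nb u \<inter> nb v \<inter> Y A))))
        \<le> P (\<lambda>A. ?f A + (\<Sum>u\<in>?U. ?g u A))"
      proof (rule P_mono)
        fix A
        have "?g u A \<le> (\<Sum>u\<in>?U. ?g u A)" if "u \<in> ?U" for u
          using finV that by (intro member_le_sum) auto
        moreover have "0 \<le> (\<Sum>u\<in>?U. ?g u A)" by (intro sum_nonneg) auto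
        ultimately show "of_bool (?th * D < card (nb v \<inter> Y A) \<or>
          (\<exists>u\<in>V. \<not> Q u v \<and> ?th * C < card (nb u \<inter> nb v \<inter> Y A))) \<le> ?f A + (\<Sum>u\<in>?U. ?g u A)"
          by fastforce
      qed
      also have "\<dots> = P ?f + (\<Sum>u\<in>?U. P (?g u))"
        unfolding P_def distrib_left sum.distrib sum_distrib_left
        by (subst sum.swap) simp
      also have "\<dots> \<le> ?e + (\<Sum>u\<in>?U. ?e)"
      proof (intro add_mono sum_mono)
        show "P ?f \<le> ?e"
          using nb[OF v] v G C by (intro tail) (auto simp: nb_def sparse_graph_def)
        fix u assume u: "u \<in> ?U"
        have "nb u \<inter> nb v = {w\<in>V. E u w \<and> E v w}" by (auto simp: nb_def)
        then have "real (card (nb u \<inter> nb v)) \<le> C" using u v G by (simp add: sparse_graph_def)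
        then show "P (?g u) \<le> ?e" using nb[OF v] by (intro tail) auto
      qed
      also have "\<dots> = (1 + real (card ?U)) * ?e" by (simp add: algebra_simps)
      also have "\<dots> \<le> (1 + N) * ?e"
      proof (rule mult_right_mono)
        have "card ?U \<le> card V" using finV by (intro card_mono) auto
        then show "1 + real (card ?U) \<le> 1 + N" using N by linarith
      qed simp
      also note k
      finally show "P (\<lambda>A. of_bool (?th * D < card (nb v \<inter> Y A) \<or>
          (\<exists>u\<in>V. \<not> Q u v \<and> ?th * C < card (nb u \<inter> nb v \<inter> Y A)))) \<le> \<delta>" .
    qed
    finally show ?thesis by (simp add: mult.commute)
  qed
  have "P (\<lambda>A. card (Sel A) + c * (real (card (W A)) - card (bad A))) \<le> P (\<lambda>A. real (indep_num E V))"
    using step by (rule P_mono)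
  also have "\<dots> = real (indep_num E V)"
    unfolding P_def sum_distrib_right[symmetric] bern_wt_total[OF fin\<Omega>] by simp
  also have "P (\<lambda>A. card (Sel A) + c * (real (card (W A)) - card (bad A)))
     = P (\<lambda>A. card (Sel A)) + c * (P (\<lambda>A. card (W A)) - P (\<lambda>A. card (bad A)))"
    unfolding P_def
    by (simp add: distrib_left right_diff_distrib sum.distrib sum_subtractf sum_distrib_left mult_ac)
  finally have main: "P (\<lambda>A. card (Sel A)) + c * (P (\<lambda>A. card (W A)) - P (\<lambda>A. card (bad A)))
    \<le> real (indep_num E V)" .
  have "c * ((1 - \<gamma> - \<delta>) * card V - \<delta> * card V) \<le> c * (P (\<lambda>A. card (W A)) - P (\<lambda>A. card (bad A)))"
    using EW Ebad c by (intro mult_left_mono) auto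
  then show ?thesis using main ESel by (simp add: algebra_simps)
qed

text \<open>Iterates \<open>nibble_step\<close>. A round multiplies \<open>D\<close> and
  \<open>C\<close> by \<open>1 - \<gamma> + \<delta>\<close> and the number of vertices by at least
  about \<open>1 - \<gamma> - 2 * \<delta>\<close>, so the vertices per unit of degree drop only by
  a factor \<open>1 - 4 * \<delta>\<close>. As \<open>K\<close> does not shrink, its bound is
  required against the value of \<open>C\<close> after \<open>T\<close> rounds.\<close>

lemma nibble:
  fixes \<gamma> \<delta> D C K N :: real and k T :: nat
  assumes G: "sparse_graph E Q V D C K" and N: "real (card V) \<le> N"
    and \<gamma>: "0 < \<gamma>" "\<gamma> \<le> 1/4" and \<delta>: "0 < \<delta>" "\<delta> \<le> \<gamma>" "\<gamma>\<^sup>2 \<le> \<delta> / 2"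
    and K: "1 \<le> K" "k * K \<le> \<delta> * (C * (1 - \<gamma> + \<delta>) ^ T) / 4" and C: "0 < C" "8 * \<gamma> * k * C \<le> \<delta> * D" "C \<le> D"
    and k: "1 \<le> k" "(1 + N) * exp (- (k * \<delta> / 4)) \<le> \<delta>"
  shows "\<gamma> * (1 - \<gamma>) * (\<Sum>j<T. (1 - 4 * \<delta>) ^ j) / D * real (card V) \<le> real (indep_num E V)"
  using G N K(2) C
proof (induction T arbitrary: V D C)
  case 0
  then show ?case by simp
next
  case (Suc T)
  let ?th = "1 - \<gamma> + \<delta>"
  let ?s = "\<Sum>j<T. (1 - 4 * \<delta>) ^ j"
  have th: "0 < ?th" "?th \<le> 1" using \<gamma> \<delta> by auto
  \<comment> \<open>The proportion that \<open>T\<close> further rounds extract from a graph whose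
    degree bound has already shrunk to \<open>?th * D\<close>.\<close>
  define c where "c = \<gamma> * (1 - \<gamma>) * ?s / (?th * D)"
  have kK: "k * K \<le> \<delta> * C / 4"
  proof -
    have "C * ?th ^ Suc T \<le> C" using th Suc.prems power_le_one[of ?th "Suc T"] by simp
    then have "\<delta> * (C * ?th ^ Suc T) \<le> \<delta> * C" using \<delta> by (intro mult_left_mono) auto
    then show ?thesis using Suc.prems(3) by linarith
  qed
  \<comment> \<open>Since \<open>1 \<le> K\<close>, the bound on \<open>k * K\<close> keeps
    \<open>C\<close>, and with it \<open>D\<close>, from falling below 1 during the iteration. The
    lower bounds on \<open>D\<close> required by \<open>nibble_step\<close> follow from
    this.\<close>
  have C1: "1 \<le> C"
  proof -
    have "1 \<le> k * K" using k(1) K(1) mult_mono[of 1 "real k" 1 K] by simp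
    moreover have "\<delta> * C \<le> 1 * C" using \<delta> \<gamma> Suc.prems by (intro mult_right_mono) auto
    ultimately show ?thesis using kK Suc.prems by linarith
  qed
  have D0: "1 \<le> D" using C1 Suc.prems by simp
  have s0: "0 \<le> ?s" using \<delta> \<gamma> \<open>\<gamma>\<^sup>2 \<le> \<delta> / 2\<close> by (intro sum_nonneg zero_le_power) auto
  have main: "(\<gamma> * (1 - \<gamma>) / D + c * (1 - \<gamma> - 2 * \<delta>)) * real (card V) \<le> real (indep_num E V)"
  proof (rule nibble_step[OF Suc.prems(1) Suc.prems(2) \<gamma> \<delta>])
    show "0 \<le> c" unfolding c_def using s0 \<gamma> th D0 by (intro divide_nonneg_nonneg mult_nonneg_nonneg) auto
    have "1 * 1 \<le> real k * C" using k C1 by (intro mult_mono) auto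
    then have "8 * \<gamma> * 1 \<le> 8 * \<gamma> * (real k * C)" using \<gamma> by (intro mult_left_mono) auto
    also have "\<dots> \<le> \<delta> * D" using Suc.prems(5) by (simp only: mult.assoc)
    finally show "2 * \<gamma> \<le> \<delta> * D" using \<gamma> by linarith
    fix V' assume V': "V' \<subseteq> V" "sparse_graph E Q V' (?th * D) (?th * C) K"
    have "card V' \<le> card V" using V' Suc.prems(1) by (intro card_mono) (auto simp: sparse_graph_def)
    then have N': "real (card V') \<le> N" using Suc.prems by linarith
    have "\<gamma> * (1 - \<gamma>) * ?s / (?th * D) * real (card V') \<le> real (indep_num E V')"
    proof (rule Suc.IH[OF V'(2) N'])
      show "k * K \<le> \<delta> * (?th * C * ?th ^ T) / 4" using Suc.prems by (simp add: mult_ac)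
      have "?th * (8 * \<gamma> * k * C) \<le> ?th * (\<delta> * D)" using Suc.prems th by (intro mult_left_mono) auto
      then show "8 * \<gamma> * k * (?th * C) \<le> \<delta> * (?th * D)" by (simp add: mult_ac)
    qed (use Suc.prems th in auto)
    then show "c * real (card V') \<le> real (indep_num E V')" by (simp add: c_def)
  qed (use Suc.prems K(1) k kK D0 in auto)
  have "(\<Sum>j<Suc T. (1 - 4 * \<delta>) ^ j) = 1 + (1 - 4 * \<delta>) * ?s"
    by (subst sum.lessThan_Suc_shift) (simp add: sum_distrib_left)
  then have "\<gamma> * (1 - \<gamma>) * (\<Sum>j<Suc T. (1 - 4 * \<delta>) ^ j) / D
      = \<gamma> * (1 - \<gamma>) / D + \<gamma> * (1 - \<gamma>) / D * ((1 - 4 * \<delta>) * ?s)"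
    by (simp only: distrib_left add_divide_distrib mult_1_right times_divide_eq_left)
  \<comment> \<open>Shrinking vertex set against shrinking degree: their ratio is at least
    \<open>1 - 4 * \<delta>\<close>, where \<open>\<gamma> \<le> 1/4\<close> makes the mixed term
    harmless.\<close>
  also have "\<dots> \<le> \<gamma> * (1 - \<gamma>) / D + \<gamma> * (1 - \<gamma>) / D * ((1 - \<gamma> - 2 * \<delta>) / ?th * ?s)"
  proof -
    have "(1 - 4 * \<delta>) * ?th = 1 - \<gamma> - 2 * \<delta> - \<delta> * (1 - \<gamma> * 4) - \<delta> * (\<delta> * 4)"
      by (simp add: algebra_simps)
    moreover have "0 \<le> \<delta> * (1 - \<gamma> * 4)" "0 \<le> \<delta> * (\<delta> * 4)" using \<gamma> \<delta> by auto
    ultimately have "(1 - 4 * \<delta>) * ?th \<le> 1 - \<gamma> - 2 * \<delta>" by linarith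
    then have "1 - 4 * \<delta> \<le> (1 - \<gamma> - 2 * \<delta>) / ?th" using th by (simp add: pos_le_divide_eq)
    then show ?thesis using s0 \<gamma> D0 by (intro add_left_mono mult_left_mono mult_right_mono) auto
  qed
  also have "\<dots> = \<gamma> * (1 - \<gamma>) / D + c * (1 - \<gamma> - 2 * \<delta>)" by (simp add: c_def mult_ac)
  finally show ?case using main by (meson mult_right_mono of_nat_0_le_iff order_trans)
qed

section \<open>Volumes of balls and boxes\<close>

lemma eucl_norm_eq_L2_set: "eucl_norm d x = L2_set x {..<d}"
  by (simp add: eucl_norm_def L2_set_def)

lemma abs_le_L2_set: "i < d \<Longrightarrow> \<bar>x i\<bar> \<le> L2_set x {..<(d::nat)}"
  using member_le_L2_set[of "{..<d}" i "\<lambda>i. \<bar>x i\<bar>"] by (simp add: L2_set_def)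

lemma L2_set_le_sqrt:
  assumes "\<And>i. i < d \<Longrightarrow> \<bar>x i\<bar> \<le> s" "0 \<le> s"
  shows "L2_set x {..<(d::nat)} \<le> s * sqrt d"
proof -
  have "(x i)\<^sup>2 \<le> s\<^sup>2" if "i < d" for i
    using assms(1)[OF that] by (metis abs_ge_zero power2_abs power_mono)
  then have "(\<Sum>i<d. (x i)\<^sup>2) \<le> (\<Sum>i<d. s\<^sup>2)" by (intro sum_mono) auto
  then have "L2_set x {..<d} \<le> sqrt (d * s\<^sup>2)" unfolding L2_set_def by (intro real_sqrt_le_mono) simp
  then show ?thesis using assms(2) by (simp add: real_sqrt_mult mult.commute)
qed

lemma L2_set_le_add:
  assumes "\<And>i. i < d \<Longrightarrow> \<bar>x i - y i\<bar> \<le> s" "0 \<le> s"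
  shows "L2_set x {..<(d::nat)} \<le> L2_set y {..<d} + s * sqrt d"
proof -
  have "L2_set x {..<d} = L2_set (\<lambda>i. y i + (x i - y i)) {..<d}" by simp
  also have "\<dots> \<le> L2_set y {..<d} + L2_set (\<lambda>i. x i - y i) {..<d}" by (rule L2_set_triangle_ineq)
  also have "L2_set (\<lambda>i. x i - y i) {..<d} \<le> s * sqrt d" by (rule L2_set_le_sqrt[OF assms])
  finally show ?thesis by simp
qed

abbreviation "lb d \<equiv> Pi\<^sub>M {..<d} (\<lambda>_. lborel :: real measure)"

lemma ball0_eq: "ball0 d R = {f. sqrt (\<Sum>i<d. (f i)\<^sup>2) \<le> R} \<inter> space (lb d)"
  by (auto simp: ball0_def Rd_def eucl_norm_def space_PiM)

lemma ball0_sets: "ball0 d R \<in> sets (lb d)"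
proof -
  have "ball0 d R = {f \<in> space (lb d). sqrt (\<Sum>i<d. (f i)\<^sup>2) \<le> R}" by (auto simp: ball0_eq)
  then show ?thesis by simp
qed

lemma emeasure_ball0: "0 < R \<Longrightarrow> emeasure (lb d) (ball0 d R) = ennreal (unit_ball_vol d * R ^ d)"
  unfolding ball0_eq using emeasure_cball_aux[of "{..<d}" R] by simp

lemma vol_ball0: "0 < R \<Longrightarrow> vol d (ball0 d R) = unit_ball_vol d * R ^ d"
  unfolding vol_def measure_def by (simp add: emeasure_ball0)

text \<open>The \<open>THE\<close> in \<open>r_d\<close> is justified by the volume formula, since
  \<open>unit_ball_vol d * r ^ d = 1\<close> has exactly one positive root. In dimension 0 every
  positive radius would qualify.\<close>

lemma r_d:
  assumes "0 < d"
  shows "0 < r_d d" "unit_ball_vol d * r_d d ^ d = 1"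
proof -
  let ?r = "root d (1 / unit_ball_vol d)"
  have u: "unit_ball_vol (real d) \<noteq> 0" using less_imp_neq[OF unit_ball_vol_pos, of d] by auto
  have r: "0 < ?r" "vol d (ball0 d ?r) = 1"
    using assms u by (auto simp: vol_ball0)
  have "\<exists>!r. r > 0 \<and> vol d (ball0 d r) = 1"
  proof (rule ex1I[of _ ?r])
    show "?r > 0 \<and> vol d (ball0 d ?r) = 1" using r by simp
    fix r' assume r': "r' > 0 \<and> vol d (ball0 d r') = 1"
    then have "unit_ball_vol d * r' ^ d = 1" using vol_ball0[of r' d] by simp
    then have "r' ^ d = 1 / unit_ball_vol d" using u by (simp add: eq_divide_eq mult.commute)
    then show "r' = ?r" using r' real_root_power_cancel[OF assms, of r'] by simp
  qed
  then have "r_d d > 0 \<and> vol d (ball0 d (r_d d)) = 1" unfolding r_d_def by (rule theI')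
  then show "0 < r_d d" "unit_ball_vol d * r_d d ^ d = 1" by (auto simp: vol_ball0)
qed

text \<open>Removes the Gamma function: from here on every ball volume is a power of a ratio of
  radii.\<close>

lemma unit_ball_vol_eq_r_d: "0 < d \<Longrightarrow> unit_ball_vol d * R ^ d = (R / r_d d) ^ d"
  using r_d[of d] by (simp add: power_divide field_simps)

lemma emeasure_PiE_lborel:
  assumes "\<And>i. i < d \<Longrightarrow> emeasure lborel (A i :: real set) = ennreal s" "\<And>i. A i \<in> sets borel" "0 \<le> s"
  shows "emeasure (lb d) (Pi\<^sub>E {..<d} A) = ennreal (s ^ d)"
proof -
  interpret product_sigma_finite "\<lambda>_. lborel :: real measure" by standard
  have "emeasure (lb d) (Pi\<^sub>E {..<d} A) = (\<Prod>i<d. emeasure lborel (A i))"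
    using assms by (intro emeasure_PiM) auto
  also have "\<dots> = (\<Prod>i<d. ennreal s)" using assms by (intro prod.cong) auto
  finally show ?thesis using assms by (simp add: ennreal_power)
qed

text \<open>Half-open cubes, so that distinct lattice points give disjoint cells which together
  still cover the space. The shift \<open>c\<close> moves the centre of a ball to the
  origin.\<close>

definition cell :: "nat \<Rightarrow> real \<Rightarrow> (nat \<Rightarrow> real) \<Rightarrow> (nat \<Rightarrow> int) \<Rightarrow> (nat \<Rightarrow> real) set" where
  "cell d s c z = Pi\<^sub>E {..<d} (\<lambda>i. {s * z i - c i ..< s * z i - c i + s})"

lemma cell_sets: "cell d s c z \<in> sets (lb d)"
  unfolding cell_def by (intro sets_PiM_I_finite) auto

lemma emeasure_cell: "0 \<le> s \<Longrightarrow> emeasure (lb d) (cell d s c z) = ennreal (s ^ d)"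
  unfolding cell_def by (rule emeasure_PiE_lborel) auto

lemma cell_disjoint:
  assumes s: "0 < s" and zz: "z \<in> Pi\<^sub>E {..<d} (\<lambda>_. UNIV)" "z' \<in> Pi\<^sub>E {..<d} (\<lambda>_. UNIV)" "z \<noteq> z'"
  shows "cell d s c z \<inter> cell d s c z' = {}"
proof (rule ccontr)
  assume "cell d s c z \<inter> cell d s c z' \<noteq> {}"
  then obtain y where y: "y \<in> cell d s c z" "y \<in> cell d s c z'" by blast
  have "z i = z' i" if "i < d" for i
  proof -
    have "s * z i - c i \<le> y i" "y i < s * z i - c i + s" "s * z' i - c i \<le> y i" "y i < s * z' i - c i + s"
      using y that by (auto simp: cell_def PiE_iff)
    then have "s * z i < s * (z' i + 1)" "s * z' i < s * (z i + 1)" by (simp_all add: algebra_simps)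
    then have "real_of_int (z i) < z' i + 1" "real_of_int (z' i) < z i + 1"
      using s by (simp_all add: mult_less_cancel_left_pos del: mult_less_cancel_left)
    then show ?thesis by linarith
  qed
  then show False using zz PiE_ext[of z "{..<d}" "\<lambda>_. UNIV" z'] by auto
qed

text \<open>The unit cells at the points of \<open>Z\<close>, shifted by \<open>c\<close>, are
  disjoint and lie in the ball of radius \<open>t + sqrt d\<close>; compare volumes. The real centre
  \<open>c\<close> allows midpoints of lattice points.\<close>

lemma card_int_points_le:
  fixes t :: real
  assumes d: "0 < d" and Z: "Z \<subseteq> Pi\<^sub>E {..<d} (\<lambda>_. UNIV :: int set)" "finite Z"
    and t: "\<And>z. z \<in> Z \<Longrightarrow> L2_set (\<lambda>i. z i - c i) {..<d} \<le> t" and t0: "0 \<le> t"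
  shows "real (card Z) \<le> ((t + sqrt d) / r_d d) ^ d"
proof -
  have pos: "0 < t + sqrt d" using t0 d by (simp add: add_nonneg_pos)
  have disj: "disjoint_family_on (cell d 1 c) Z"
    unfolding disjoint_family_on_def using Z(1) by (intro ballI impI cell_disjoint) auto
  have "(\<Union>z\<in>Z. cell d 1 c z) \<subseteq> ball0 d (t + sqrt d)"
  proof (rule UN_least)
    fix z assume z: "z \<in> Z"
    show "cell d 1 c z \<subseteq> ball0 d (t + sqrt d)"
    proof
      fix y assume y: "y \<in> cell d 1 c z"
      have "L2_set y {..<d} \<le> L2_set (\<lambda>i. z i - c i) {..<d} + 1 * sqrt d"
      proof (rule L2_set_le_add)
        fix i assume "i < d"
        then have "real_of_int (z i) - c i \<le> y i" "y i < z i - c i + 1"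
          using y by (auto simp: cell_def PiE_iff)
        then show "\<bar>y i - (z i - c i)\<bar> \<le> 1" by simp
      qed simp
      then show "y \<in> ball0 d (t + sqrt d)"
        using t[OF z] y by (auto simp: ball0_def Rd_def eucl_norm_eq_L2_set cell_def)
    qed
  qed
  then have "emeasure (lb d) (\<Union>z\<in>Z. cell d 1 c z) \<le> emeasure (lb d) (ball0 d (t + sqrt d))"
    by (intro emeasure_mono ball0_sets)
  also have "emeasure (lb d) (\<Union>z\<in>Z. cell d 1 c z) = (\<Sum>z\<in>Z. emeasure (lb d) (cell d 1 c z))"
    using Z disj cell_sets by (intro sum_emeasure[symmetric]) auto
  also have "\<dots> = ennreal (card Z)" by (simp add: emeasure_cell ennreal_of_nat_eq_real_of_nat)
  also have "emeasure (lb d) (ball0 d (t + sqrt d)) = ennreal (((t + sqrt d) / r_d d) ^ d)"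
    using pos d by (simp add: emeasure_ball0 unit_ball_vol_eq_r_d)
  finally show ?thesis using pos r_d[OF d] by (simp add: zero_le_power)
qed

lemma finite_int_points:
  fixes s t :: real and d :: nat
  assumes s: "0 < s"
  shows "finite {z \<in> Pi\<^sub>E {..<d} (\<lambda>_. UNIV :: int set). L2_set (\<lambda>i. s * z i) {..<d} \<le> t}"
proof (rule finite_subset)
  let ?B = "{- \<lceil>t / s\<rceil> .. \<lceil>t / s\<rceil>}"
  show "{z \<in> Pi\<^sub>E {..<d} (\<lambda>_. UNIV :: int set). L2_set (\<lambda>i. s * z i) {..<d} \<le> t} \<subseteq> Pi\<^sub>E {..<d} (\<lambda>_. ?B)"
  proof clarify
    fix z :: "nat \<Rightarrow> int" and i assume z: "z \<in> Pi\<^sub>E {..<d} (\<lambda>_. UNIV)" "L2_set (\<lambda>i. s * z i) {..<d} \<le> t"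
    show "z \<in> Pi\<^sub>E {..<d} (\<lambda>_. ?B)"
      unfolding PiE_iff
    proof (intro conjI ballI)
      fix i assume "i \<in> {..<d}"
      then have "\<bar>s * z i\<bar> \<le> t" using abs_le_L2_set[of i d "\<lambda>i. s * z i"] z by simp
      then have "\<bar>real_of_int (z i)\<bar> \<le> t / s" using s by (simp add: abs_mult field_simps)
      then show "z i \<in> ?B" by (simp add: abs_le_iff) linarith
    qed (use z in \<open>auto simp: PiE_iff\<close>)
  qed
qed (intro finite_PiE, auto)

text \<open>Rounding the coordinates down puts every point of the ball of radius
  \<open>\<rho>\<close> into a cell whose corner is at most \<open>s * sqrt d\<close> away, so these
  cells cover the ball.\<close>

lemma card_int_points_ge:
  fixes s \<rho> :: real
  assumes d: "0 < d" and s: "0 < s" and \<rho>: "0 < \<rho>"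
  shows "(\<rho> / r_d d) ^ d \<le> s ^ d * real (card {z \<in> Pi\<^sub>E {..<d} (\<lambda>_. UNIV :: int set).
    L2_set (\<lambda>i. s * z i) {..<d} \<le> \<rho> + s * sqrt d})" (is "_ \<le> _ * real (card ?W)")
proof -
  have "ball0 d \<rho> \<subseteq> (\<Union>z\<in>?W. cell d s (\<lambda>_. 0) z)"
  proof
    fix y assume y: "y \<in> ball0 d \<rho>"
    define z where "z = (\<lambda>i\<in>{..<d}. \<lfloor>y i / s\<rfloor>)"
    have zi: "s * z i \<le> y i" "y i < s * z i + s" if "i < d" for i
    proof -
      have "real_of_int (z i) \<le> y i / s" "y i / s < z i + 1" using that by (simp_all add: z_def)
      then show "s * z i \<le> y i" "y i < s * z i + s" using s by (simp_all add: field_simps)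
    qed
    have "L2_set (\<lambda>i. s * z i) {..<d} \<le> L2_set y {..<d} + s * sqrt d"
    proof (rule L2_set_le_add)
      fix i assume "i < d"
      then show "\<bar>s * z i - y i\<bar> \<le> s" using zi[of i] s by (simp add: abs_le_iff)
    qed (use s in simp)
    then have "z \<in> ?W" using y by (auto simp: ball0_def eucl_norm_eq_L2_set z_def)
    moreover have "y \<in> cell d s (\<lambda>_. 0) z"
      using y zi by (auto simp: cell_def PiE_iff ball0_def Rd_def)
    ultimately show "y \<in> (\<Union>z\<in>?W. cell d s (\<lambda>_. 0) z)" by blast
  qed
  then have "emeasure (lb d) (ball0 d \<rho>) \<le> emeasure (lb d) (\<Union>z\<in>?W. cell d s (\<lambda>_. 0) z)"
    using finite_int_points[OF s] cell_sets by (intro emeasure_mono sets.finite_UN) auto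
  also have "\<dots> \<le> (\<Sum>z\<in>?W. emeasure (lb d) (cell d s (\<lambda>_. 0) z))"
    using finite_int_points[OF s] cell_sets by (intro emeasure_subadditive_finite) auto
  also have "\<dots> = (\<Sum>z\<in>?W. ennreal (s ^ d))" using s by (intro sum.cong emeasure_cell) auto
  also have "\<dots> = ennreal (\<Sum>z\<in>?W. s ^ d)" using s by (intro sum_ennreal) auto
  also have "(\<Sum>z\<in>?W. s ^ d) = s ^ d * real (card ?W)" by simp
  also have "emeasure (lb d) (ball0 d \<rho>) = ennreal ((\<rho> / r_d d) ^ d)"
    using \<rho> d by (simp add: emeasure_ball0 unit_ball_vol_eq_r_d)
  finally show ?thesis using s by (subst (asm) ennreal_le_iff) auto
qed

section \<open>Periodic packings\<close>

definition tile_pt :: "nat \<Rightarrow> real \<Rightarrow> int \<Rightarrow> (nat \<Rightarrow> int) \<times> (nat \<Rightarrow> int) \<Rightarrow> nat \<Rightarrow> real" where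
  "tile_pt d h q = (\<lambda>(x, z). \<lambda>i\<in>{..<d}. h * (x i + q * z i))"

text \<open>Copies of \<open>I\<close> are repeated with period \<open>M + b\<close> in each
  coordinate. The margin \<open>b\<close> keeps points of different copies \<open>b\<close> apart in
  some coordinate, so the result is a packing, with \<open>card I\<close> points per period cube of
  volume \<open>(h * (M + b)) ^ d\<close>.\<close>

lemma theta_ge_periodic:
  fixes M b :: nat and h :: real
  assumes d: "0 < d" and h: "0 < h" "2 * r_d d \<le> h * b"
    and I: "I \<subseteq> Pi\<^sub>E {..<d} (\<lambda>_. {0..<int M})"
    and sep: "\<And>x y. x \<in> I \<Longrightarrow> y \<in> I \<Longrightarrow> x \<noteq> y \<Longrightarrow> real b \<le> L2_set (\<lambda>i. real_of_int (x i - y i)) {..<d}"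
  shows "ereal (real (card I) / (h * (M + b)) ^ d) \<le> theta d"
proof -
  let ?q = "int (M + b)" and ?s = "h * (M + b)" and ?L = "Pi\<^sub>E {..<d} (\<lambda>_. UNIV :: int set)"
  define P where "P = tile_pt d h ?q ` (I \<times> ?L)"
  have r: "0 < r_d d" by (rule r_d(1)[OF d])
  have b: "0 < b" using h r by (cases b) auto
  have s: "0 < ?s" using b h by simp
  have finI: "finite I" using I by (rule finite_subset) (auto intro: finite_PiE)
  \<comment> \<open>The coordinates of \<open>I\<close> lie below the period, so a tiled point
    determines both its copy and its position in it; \<open>inj\<close> follows.\<close>
  have coord: "x i = w i mod ?q" "z i = w i div ?q"
    if "x \<in> I" "i < d" "w i = x i + ?q * z i" for x z w :: "nat \<Rightarrow> int" and i
  proof -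
    have "x i \<in> {0..<int M}" using that(1,2) I by (auto simp: PiE_iff subset_iff)
    then show "x i = w i mod ?q" "z i = w i div ?q" using that b by auto
  qed
  have inj: "inj_on (tile_pt d h ?q) (I \<times> ?L)"
  proof (rule inj_onI)
    fix u v assume uv: "u \<in> I \<times> ?L" "v \<in> I \<times> ?L" "tile_pt d h ?q u = tile_pt d h ?q v"
    obtain x z y w where eq: "u = (x, z)" "v = (y, w)" by (cases u, cases v)
    have "x i = y i \<and> z i = w i" if i: "i < d" for i
    proof -
      have "h * (x i + ?q * z i) = h * (y i + ?q * w i)"
        using fun_cong[OF uv(3), of i] i eq by (simp add: tile_pt_def)
      then have "real_of_int (x i + ?q * z i) = real_of_int (y i + ?q * w i)" using h by simp
      then have "x i + ?q * z i = y i + ?q * w i" by linarith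
      then show ?thesis
        using coord[of x i "\<lambda>i. x i + ?q * z i" z] coord[of y i "\<lambda>i. x i + ?q * z i" w] uv eq i b by simp
    qed
    moreover have "x \<in> ?L" "y \<in> ?L" "z \<in> ?L" "w \<in> ?L" using uv eq I by (auto simp: PiE_iff subset_iff)
    ultimately have "x = y" "z = w"
      using PiE_ext[of x "{..<d}" "\<lambda>_. UNIV" y] PiE_ext[of z "{..<d}" "\<lambda>_. UNIV" w] by auto
    then show "u = v" using eq by simp
  qed
  have pack: "sphere_packing d P"
    unfolding sphere_packing_def
  proof (intro conjI ballI impI)
    show "P \<subseteq> Rd d" by (auto simp: P_def tile_pt_def Rd_def)
    fix u v assume uv: "u \<in> P" "v \<in> P" "u \<noteq> v"
    obtain x z where u: "u = tile_pt d h ?q (x, z)" "x \<in> I" "z \<in> ?L" using uv by (auto simp: P_def)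
    obtain y w where v: "v = tile_pt d h ?q (y, w)" "y \<in> I" "w \<in> ?L" using uv by (auto simp: P_def)
    let ?D = "\<lambda>i. real_of_int (x i - y i + ?q * (z i - w i))"
    have "eucl_norm d (u - v) = L2_set (\<lambda>i. h * ?D i) {..<d}"
      unfolding eucl_norm_eq_L2_set
      by (intro L2_set_cong) (auto simp: u v tile_pt_def algebra_simps)
    also have "\<dots> = h * L2_set ?D {..<d}" using h by (intro L2_set_right_distrib[symmetric]) simp
    also have "\<dots> \<ge> h * b"
    proof (rule mult_left_mono)
      show "real b \<le> L2_set ?D {..<d}"
      proof (cases "z = w")
        case True
        then have "x \<noteq> y" using uv(3) u v by auto
        then show ?thesis using sep[of x y] u v True by simp
      next
        case False
        then obtain i where i: "i < d" "z i \<noteq> w i"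
          using u v PiE_ext[of z "{..<d}" "\<lambda>_. UNIV" w] by auto
        have xy: "x i \<in> {0..<int M}" "y i \<in> {0..<int M}" using u v i I by (auto simp: PiE_iff subset_iff)
        \<comment> \<open>Different copies are shifted by at least \<open>M + b\<close> in
          coordinate \<open>i\<close>, while \<open>x i\<close> and \<open>y i\<close> differ by
          less than \<open>M\<close>.\<close>
        have "int (M + b) * 1 \<le> int (M + b) * \<bar>z i - w i\<bar>" using i by (intro mult_left_mono) auto
        then have "int (M + b) \<le> \<bar>?q * (z i - w i)\<bar>" by (simp add: abs_mult)
        then have "int b \<le> \<bar>x i - y i + ?q * (z i - w i)\<bar>" using xy by auto
        then have "real b \<le> \<bar>?D i\<bar>" by linarith
        also have "\<dots> \<le> L2_set ?D {..<d}" by (rule abs_le_L2_set[OF i(1)])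
        finally show ?thesis .
      qed
    qed (use h in simp)
    finally show "2 * r_d d \<le> eucl_norm d (u - v)" using h by linarith
  qed
  \<comment> \<open>\<open>?t\<close> pays \<open>?s * sqrt d\<close> twice: for covering a ball by
    period cubes, and for the position of a point within its cube.\<close>
  let ?c = "real (card I) / ?s ^ d" and ?t = "2 * ?s * sqrt d"
  \<comment> \<open>Needed because \<open>card\<close> of an infinite set is 0.\<close>
  have finP: "finite (P \<inter> ball0 d R)" for R
  proof (rule finite_subset)
    let ?F = "{w \<in> ?L. L2_set (\<lambda>i. h * w i) {..<d} \<le> R}"
    show "P \<inter> ball0 d R \<subseteq> (\<lambda>w. \<lambda>i\<in>{..<d}. h * real_of_int (w i)) ` ?F"
    proof
      fix u assume u: "u \<in> P \<inter> ball0 d R"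
      then obtain x z where xz: "u = tile_pt d h ?q (x, z)" by (auto simp: P_def)
      let ?w = "\<lambda>i\<in>{..<d}. x i + ?q * z i"
      have eq: "u = (\<lambda>i\<in>{..<d}. h * real_of_int (?w i))"
        by (auto simp: xz tile_pt_def fun_eq_iff)
      have "L2_set (\<lambda>i. h * ?w i) {..<d} = L2_set u {..<d}"
        unfolding eq by (intro L2_set_cong) auto
      then have "?w \<in> ?F" using u by (auto simp: ball0_def eucl_norm_eq_L2_set)
      then show "u \<in> (\<lambda>w. \<lambda>i\<in>{..<d}. h * real_of_int (w i)) ` ?F" using eq by blast
    qed
    show "finite ((\<lambda>w. \<lambda>i\<in>{..<d}. h * real_of_int (w i)) ` ?F)"
      by (intro finite_imageI finite_int_points h)
  qed
  have lower: "?c * ((R - ?t) / R) ^ d \<le> real (card (P \<inter> ball0 d R)) / vol d (ball0 d R)" if R: "?t < R" for R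
  proof -
    have t0: "0 \<le> ?t" using s by simp
    have R0: "0 < R" using R t0 by linarith
    let ?W = "{z \<in> ?L. L2_set (\<lambda>i. ?s * z i) {..<d} \<le> (R - ?t) + ?s * sqrt d}"
    have W: "((R - ?t) / r_d d) ^ d \<le> ?s ^ d * real (card ?W)"
      using R by (intro card_int_points_ge[OF d s]) simp
    have sub: "tile_pt d h ?q ` (I \<times> ?W) \<subseteq> P \<inter> ball0 d R"
    proof
      fix u assume "u \<in> tile_pt d h ?q ` (I \<times> ?W)"
      then obtain x z where u: "u = tile_pt d h ?q (x, z)" "x \<in> I" "z \<in> ?W" by auto
      have "L2_set u {..<d} \<le> L2_set (\<lambda>i. ?s * z i) {..<d} + ?s * sqrt d"
      proof (rule L2_set_le_add)
        fix i assume i: "i < d"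
        then have x: "0 \<le> x i" "x i \<le> M" using u(2) I by (auto simp: PiE_iff subset_iff less_imp_le)
        have "u i - ?s * z i = h * x i" using i by (simp add: u tile_pt_def algebra_simps)
        moreover have "0 \<le> h * x i" using h x by simp
        moreover have "h * x i \<le> ?s" using h x by (intro mult_left_mono) auto
        ultimately show "\<bar>u i - ?s * z i\<bar> \<le> ?s" by simp
      qed (use s in simp)
      also have "\<dots> \<le> R" using u by (simp add: algebra_simps)
      finally show "u \<in> P \<inter> ball0 d R"
        using u by (auto simp: P_def ball0_def Rd_def eucl_norm_eq_L2_set tile_pt_def)
    qed
    have "card I * card ?W = card (tile_pt d h ?q ` (I \<times> ?W))"
      by (subst card_image[OF inj_on_subset[OF inj]]) (auto simp: card_cartesian_product)
    also have "\<dots> \<le> card (P \<inter> ball0 d R)" by (rule card_mono[OF finP sub])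
    finally have 1: "real (card I) * real (card ?W) \<le> real (card (P \<inter> ball0 d R))"
      unfolding of_nat_mult[symmetric] of_nat_le_iff .
    have "?c * ((R - ?t) / R) ^ d = ?c * ((R - ?t) / r_d d) ^ d / (R / r_d d) ^ d"
      using r by (simp add: power_divide)
    also have "\<dots> \<le> ?c * (?s ^ d * real (card ?W)) / (R / r_d d) ^ d"
      using W s R0 r by (intro divide_right_mono mult_left_mono) auto
    also have "?c * (?s ^ d * real (card ?W)) = real (card I) * real (card ?W)"
      using h b by simp
    also have "\<dots> / (R / r_d d) ^ d \<le> real (card (P \<inter> ball0 d R)) / (R / r_d d) ^ d"
      using 1 R0 r by (intro divide_right_mono) auto
    finally show ?thesis using R0 d by (simp add: vol_ball0 unit_ball_vol_eq_r_d)
  qed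
  have "((\<lambda>R. ?c * ((R - ?t) / R) ^ d) \<longlongrightarrow> ?c * 1 ^ d) at_top"
  proof (intro tendsto_intros)
    have "((\<lambda>R. 1 - ?t * inverse R) \<longlongrightarrow> 1 - ?t * 0) at_top"
      by (intro tendsto_intros tendsto_inverse_0_at_top filterlim_ident)
    then have lim: "((\<lambda>R. 1 - ?t * inverse R) \<longlongrightarrow> 1) at_top" by simp
    have "eventually (\<lambda>R. 1 - ?t * inverse R = (R - ?t) / R) at_top"
      using eventually_gt_at_top[of 0] by eventually_elim (simp add: diff_divide_distrib flip: divide_inverse)
    then show "((\<lambda>R. (R - ?t) / R) \<longlongrightarrow> 1) at_top" by (rule Lim_transform_eventually[OF lim])
  qed
  then have "((\<lambda>R. ereal (?c * ((R - ?t) / R) ^ d)) \<longlongrightarrow> ereal ?c) at_top" by simp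
  then have "ereal ?c = Limsup at_top (\<lambda>R. ereal (?c * ((R - ?t) / R) ^ d))"
    by (intro lim_imp_Limsup[symmetric]) auto
  also have "\<dots> \<le> upper_density d P"
    unfolding upper_density_def
    using eventually_gt_at_top[of ?t] by (intro Limsup_mono, eventually_elim) (use lower in auto)
  also have "\<dots> \<le> theta d" unfolding theta_def using pack by (intro SUP_upper) simp
  finally show ?thesis .
qed

section \<open>The grid graph\<close>

definition ldist :: "nat \<Rightarrow> (nat \<Rightarrow> int) \<Rightarrow> (nat \<Rightarrow> int) \<Rightarrow> real" where
  "ldist d x y = L2_set (\<lambda>i. real_of_int (x i - y i)) {..<d}"

lemma ldist_commute: "ldist d x y = ldist d y x"
  unfolding ldist_def L2_set_def by (simp add: power2_commute)

lemma ldist_self: "ldist d x x = 0"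
  by (simp add: ldist_def L2_set_def)

text \<open>The median length formula in the triangle \<open>u\<close>, \<open>v\<close>,
  \<open>w\<close>. It confines the common neighbours of a far pair to a smaller ball around the
  midpoint.\<close>

lemma ldist_midpoint:
  "(L2_set (\<lambda>i. real_of_int (w i) - (real_of_int (u i) + real_of_int (v i)) / 2) {..<d})\<^sup>2 =
    ((ldist d u w)\<^sup>2 + (ldist d v w)\<^sup>2) / 2 - (ldist d u v)\<^sup>2 / 4"
proof -
  have sq: "(L2_set f {..<d})\<^sup>2 = (\<Sum>i<d. (f i)\<^sup>2)" for f :: "nat \<Rightarrow> real"
    unfolding L2_set_def by (simp add: sum_nonneg)
  show ?thesis
    unfolding ldist_def sq sum_divide_distrib sum.distrib[symmetric] sum_subtractf[symmetric]
    by (intro sum.cong) (auto simp: power2_eq_square field_simps)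
qed

text \<open>All three bounds count integer points in a ball: of radius \<open>\<rho>\<close> for
  degrees, of radius \<open>\<sigma>\<close> for close vertices, and around the midpoint for
  codegrees.\<close>

lemma lattice_sparse_graph:
  fixes \<rho> \<sigma> :: real
  assumes d: "0 < d" and V: "V \<subseteq> Pi\<^sub>E {..<d} (\<lambda>_. UNIV)" "finite V" and \<sigma>: "0 < \<sigma>" "\<sigma> \<le> 2 * \<rho>"
  shows "sparse_graph (\<lambda>x y. x \<noteq> y \<and> ldist d x y < \<rho>) (\<lambda>x y. ldist d x y < \<sigma>) V
    (((\<rho> + sqrt d) / r_d d) ^ d) (((sqrt (\<rho>\<^sup>2 - \<sigma>\<^sup>2 / 4) + sqrt d) / r_d d) ^ d)
    (((\<sigma> + sqrt d) / r_d d) ^ d)"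
  unfolding sparse_graph_def
proof (intro conjI ballI impI)
  have count: "real (card {u\<in>V. P u}) \<le> ((t + sqrt d) / r_d d) ^ d"
    if "\<And>u. u \<in> V \<Longrightarrow> P u \<Longrightarrow> L2_set (\<lambda>i. u i - c i) {..<d} \<le> t" "0 \<le> t" for P t and c :: "nat \<Rightarrow> real"
    using V that by (intro card_int_points_le[OF d]) auto
  fix v assume v: "v \<in> V"
  show "real (card {u\<in>V. v \<noteq> u \<and> ldist d v u < \<rho>}) \<le> ((\<rho> + sqrt d) / r_d d) ^ d"
    using \<sigma> ldist_commute[of d v] by (intro count[of _ "\<lambda>i. real_of_int (v i)"]) (auto simp: ldist_def)
  show "real (card {u\<in>V. ldist d u v < \<sigma>}) \<le> ((\<sigma> + sqrt d) / r_d d) ^ d"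
    using \<sigma> by (intro count[of _ "\<lambda>i. real_of_int (v i)"]) (auto simp: ldist_def)
  fix u let ?c = "\<lambda>i. (real_of_int (v i) + real_of_int (u i)) / 2"
  assume u: "u \<in> V" and far: "\<not> ldist d v u < \<sigma>"
  show "real (card {w\<in>V. (v \<noteq> w \<and> ldist d v w < \<rho>) \<and> (u \<noteq> w \<and> ldist d u w < \<rho>)})
      \<le> ((sqrt (\<rho>\<^sup>2 - \<sigma>\<^sup>2 / 4) + sqrt d) / r_d d) ^ d"
  proof (rule count[of _ ?c])
    have "\<sigma>\<^sup>2 \<le> (2 * \<rho>)\<^sup>2" using \<sigma> by (intro power_mono) auto
    then show "0 \<le> sqrt (\<rho>\<^sup>2 - \<sigma>\<^sup>2 / 4)" by (simp add: power_mult_distrib)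
  next
    have nonneg: "0 \<le> ldist d x y" for x y by (simp add: ldist_def)
    fix w assume w: "(v \<noteq> w \<and> ldist d v w < \<rho>) \<and> (u \<noteq> w \<and> ldist d u w < \<rho>)"
    have "(ldist d v w)\<^sup>2 \<le> \<rho>\<^sup>2" "(ldist d u w)\<^sup>2 \<le> \<rho>\<^sup>2" "\<sigma>\<^sup>2 \<le> (ldist d v u)\<^sup>2"
      using w far \<sigma> nonneg by (auto intro!: power_mono)
    then have "(L2_set (\<lambda>i. real_of_int (w i) - ?c i) {..<d})\<^sup>2 \<le> \<rho>\<^sup>2 - \<sigma>\<^sup>2 / 4"
      unfolding ldist_midpoint by (simp add: field_simps)
    then show "L2_set (\<lambda>i. real_of_int (w i) - ?c i) {..<d} \<le> sqrt (\<rho>\<^sup>2 - \<sigma>\<^sup>2 / 4)"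
      by (rule real_le_rsqrt)
  qed
qed (use V \<sigma> in \<open>auto simp: ldist_self ldist_commute[of d]\<close>)

lemma sparse_graph_mono:
  assumes "sparse_graph E Q V D C K" "C \<le> C'"
  shows "sparse_graph E Q V D C' K"
  using assms unfolding sparse_graph_def by (meson order_trans)

text \<open>The integer points of a cube of side \<open>d ^ 4\<close> are joined when their distance is below \<open>2 * d ^ 2\<close>, so
  that \<open>r_d d\<close> corresponds to \<open>d ^ 2\<close>; \<open>\<sigma>\<close> is the scale of closeness. The nibble runs with
  \<open>\<gamma> = d ^ -4\<close>, \<open>\<delta> = d ^ -7\<close>, \<open>k = d ^ 10\<close> for a total time \<open>\<gamma> T\<close> of about \<open>X\<close>.\<close>

lemma theta_ge_nibble:
  fixes d :: nat and X \<sigma> :: real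
  assumes d: "8 \<le> d" and X: "1 / real d ^ 4 \<le> X" "4 * X \<le> real d ^ 3" and \<sigma>: "0 < \<sigma>" "\<sigma> \<le> 4 * real d ^ 2"
    and codeg: "((sqrt ((2 * real d ^ 2)\<^sup>2 - \<sigma>\<^sup>2 / 4) + sqrt d) / (2 * real d ^ 2 + sqrt d)) ^ d \<le> 1 / real d ^ 14"
    and close: "4 * real d ^ 31 * exp X \<le> ((2 * real d ^ 2 + sqrt d) / (\<sigma> + sqrt d)) ^ d"
    and union: "(1 + (real d ^ 4) ^ d) * exp (- (real d ^ 3 / 4)) \<le> 1 / real d ^ 7"
  shows "ereal ((X - 1 / real d ^ 4) * (1 - 1 / real d ^ 4) * (1 - 4 * X / real d ^ 3)
      * (real d ^ 4 / (real d ^ 4 + 2 * real d ^ 2)) ^ d * (real d ^ 2 / (2 * real d ^ 2 + sqrt d)) ^ d) \<le> theta d"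
proof -
  \<comment> \<open>The powers balance three demands: \<open>\<delta>\<close> exceeds twice the
    square of \<open>\<gamma>\<close>, the accumulated error \<open>4 * \<delta> * T\<close> is at
    most \<open>4 * X / d ^ 3\<close>, and \<open>k * \<delta> = d ^ 3\<close> lets the tail bound
    beat the number of vertices, whose logarithm is \<open>4 * d * ln d\<close>.\<close>
  define \<gamma> \<delta> where "\<gamma> = 1 / real d ^ 4" and "\<delta> = 1 / real d ^ 7"
  define T where "T = nat \<lfloor>real d ^ 4 * X\<rfloor>"
  define D where "D = ((real (2 * d ^ 2) + sqrt d) / r_d d) ^ d"
  \<comment> \<open>The exponent 14 makes \<open>8 * \<gamma> * k * C\<close> equal to
    \<open>8 / d * (\<delta> * D)\<close>, which is at most \<open>\<delta> * D\<close> since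
    \<open>8 \<le> d\<close>.\<close>
  define C where "C = D / real d ^ 14"
  define K where "K = ((\<sigma> + sqrt d) / r_d d) ^ d"
  define V :: "(nat \<Rightarrow> int) set" where "V = Pi\<^sub>E {..<d} (\<lambda>_. {0..<int (d ^ 4)})"
  let ?E = "\<lambda>x y. x \<noteq> y \<and> ldist d x y < real (2 * d ^ 2)" and ?Q = "\<lambda>x y. ldist d x y < \<sigma>"
  have d0: "0 < d" "0 < real d" "1 \<le> real d" "8 \<le> real d" using d by auto
  have r: "0 < r_d d" by (rule r_d(1)[OF d0(1)])
  have D0: "0 < D" unfolding D_def using r d0 by (intro zero_less_power divide_pos_pos add_pos_pos) auto
  have finV: "finite V" unfolding V_def by (intro finite_PiE) auto
  have cardV: "real (card V) = (real d ^ 4) ^ d" unfolding V_def by (simp add: card_PiE)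
  have G: "sparse_graph ?E ?Q V D C K"
  proof (rule sparse_graph_mono)
    show "sparse_graph ?E ?Q V D (((sqrt ((real (2 * d ^ 2))\<^sup>2 - \<sigma>\<^sup>2 / 4) + sqrt d) / r_d d) ^ d) K"
      unfolding D_def K_def using d0 finV \<sigma> by (intro lattice_sparse_graph) (auto simp: V_def PiE_iff)
    let ?x = "sqrt ((2 * real d ^ 2)\<^sup>2 - \<sigma>\<^sup>2 / 4) + sqrt d" and ?y = "2 * real d ^ 2 + sqrt d"
    have y: "0 < ?y" using d0 by (intro add_pos_pos) auto
    have "(?x / r_d d) ^ d = D * (?x / ?y) ^ d"
      unfolding D_def power_mult_distrib[symmetric] using y by simp
    also have "\<dots> \<le> D * (1 / real d ^ 14)" using codeg D0 by (intro mult_left_mono) auto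
    finally show "((sqrt ((real (2 * d ^ 2))\<^sup>2 - \<sigma>\<^sup>2 / 4) + sqrt d) / r_d d) ^ d \<le> C" by (simp add: C_def)
  qed
  have \<gamma>: "0 < \<gamma>" "\<gamma> \<le> 1/4" and \<delta>: "0 < \<delta>" "\<delta> \<le> \<gamma>" "\<gamma>\<^sup>2 \<le> \<delta> / 2"
  proof -
    show "0 < \<gamma>" "0 < \<delta>" using d0 by (auto simp: \<gamma>_def \<delta>_def)
    have "real d \<le> real d ^ 4" using d0 by (intro self_le_power) auto
    then have "4 \<le> real d ^ 4" using d0 by linarith
    then show "\<gamma> \<le> 1/4" unfolding \<gamma>_def by (intro frac_le) auto
    show "\<delta> \<le> \<gamma>" unfolding \<gamma>_def \<delta>_def using d0 by (intro divide_left_mono power_increasing) auto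
    have "\<gamma>\<^sup>2 = \<delta> / real d" by (simp add: \<gamma>_def \<delta>_def power_divide flip: power_mult power_Suc2)
    also have "\<dots> \<le> \<delta> / 2" using d0 \<open>0 < \<delta>\<close> by (intro divide_left_mono) auto
    finally show "\<gamma>\<^sup>2 \<le> \<delta> / 2" .
  qed
  have X0: "0 \<le> X" using X d0 by (meson order_trans zero_le_divide_1_iff zero_le_power less_imp_le)
  have T: "real T \<le> real d ^ 4 * X" "real d ^ 4 * X - 1 \<le> real T"
  proof -
    have "0 \<le> real d ^ 4 * X" using X0 by simp
    then show "real T \<le> real d ^ 4 * X" "real d ^ 4 * X - 1 \<le> real T" unfolding T_def by linarith+
  qed
  have \<gamma>T: "\<gamma> * T \<le> X" "X - 1 / real d ^ 4 \<le> \<gamma> * T"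
  proof -
    show "\<gamma> * T \<le> X" using T(1) d0 by (simp add: \<gamma>_def field_simps)
    have "X - 1 / real d ^ 4 = (real d ^ 4 * X - 1) / real d ^ 4" using d0 by (simp add: diff_divide_distrib)
    also have "\<dots> \<le> T / real d ^ 4" using T(2) by (intro divide_right_mono) auto
    finally show "X - 1 / real d ^ 4 \<le> \<gamma> * T" by (simp add: \<gamma>_def)
  qed
  have \<delta>T: "4 * \<delta> * T \<le> 4 * X / real d ^ 3"
  proof -
    have "\<delta> * T \<le> \<delta> * (real d ^ 4 * X)" using T \<delta> by (intro mult_left_mono) auto
    also have "\<dots> = X / real d ^ 3" using d0 by (simp add: \<delta>_def field_simps flip: power_add)
    finally show ?thesis by simp
  qed
  let ?th = "1 - \<gamma> + \<delta>" and ?k = "d ^ 10"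
  have "\<gamma> * (1 - \<gamma>) * (\<Sum>j<T. (1 - 4 * \<delta>) ^ j) / D * real (card V) \<le> real (indep_num ?E V)"
  proof (rule nibble[OF G _ \<gamma> \<delta>])
    show "real (card V) \<le> (real d ^ 4) ^ d" by (simp add: cardV)
    let ?o = "\<lambda>i\<in>{..<d}. 0::int"
    have "real (card {?o}) \<le> K"
      unfolding K_def using \<sigma> by (intro card_int_points_le[OF d0(1), of _ "\<lambda>_. 0"]) (auto simp: L2_set_def)
    then show "1 \<le> K" by simp
    have "exp (- X) \<le> exp (- \<gamma>) ^ T"
      using \<gamma>T by (simp add: mult.commute flip: exp_of_nat_mult)
    also have "\<dots> \<le> ?th ^ T"
    proof (rule power_mono)
      have "exp (- \<gamma>) \<le> 1 - \<gamma> + \<gamma>\<^sup>2 / 2" using \<gamma> by (intro exp_minus_le_quadratic) simp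
      then show "exp (- \<gamma>) \<le> ?th" using \<delta> by linarith
    qed simp
    finally have th: "exp (- X) \<le> ?th ^ T" .
    have y: "0 < \<sigma> + sqrt d" using \<sigma> by (simp add: add_pos_nonneg)
    \<comment> \<open>The exponent 31 is 10 + 7 + 14, collecting \<open>k\<close>,
      \<open>1 / \<delta>\<close> and \<open>D / C\<close>; \<open>exp X\<close> pays for the
      shrinking of \<open>C\<close> over all rounds.\<close>
    have "4 * real d ^ 31 * exp X * K \<le> ((2 * real d ^ 2 + sqrt d) / (\<sigma> + sqrt d)) ^ d * K"
      using close \<open>1 \<le> K\<close> by (intro mult_right_mono) auto
    also have "\<dots> = D"
      unfolding K_def D_def power_mult_distrib[symmetric] using y by simp
    finally have "K \<le> D / (4 * real d ^ 31) * exp (- X)"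
      using d0 by (simp add: exp_minus field_simps)
    also have "\<dots> \<le> D / (4 * real d ^ 31) * ?th ^ T"
      using th D0 by (intro mult_left_mono) auto
    finally have "real ?k * K \<le> real ?k * (D / (4 * real d ^ 31) * ?th ^ T)" by (intro mult_left_mono) auto
    also have "\<dots> = \<delta> * (C * ?th ^ T) / 4"
      using d0 by (simp add: \<delta>_def C_def field_simps flip: power_add)
    finally show "real ?k * K \<le> \<delta> * (C * ?th ^ T) / 4" .
    show "0 < C" using D0 d0 by (simp add: C_def)
    show "C \<le> D" using D0 d0 one_le_power[of "real d" 14] by (simp add: C_def field_simps)
    have "8 * \<gamma> * real ?k * C = 8 / d * (\<delta> * D)"
      using d0 by (simp add: \<gamma>_def \<delta>_def C_def field_simps flip: power_add power_Suc)
    also have "\<dots> \<le> 1 * (\<delta> * D)" using d0 \<delta> D0 by (intro mult_right_mono) auto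
    finally show "8 * \<gamma> * real ?k * C \<le> \<delta> * D" by simp
    show "1 \<le> ?k" using d0 by simp
    have "real ?k * \<delta> = real d ^ 3" using d0 by (simp add: \<delta>_def field_simps flip: power_add)
    then show "(1 + (real d ^ 4) ^ d) * exp (- (real ?k * \<delta> / 4)) \<le> \<delta>" using union by (simp add: \<delta>_def)
  qed
  moreover have "(X - 1 / real d ^ 4) * (1 - 1 / real d ^ 4) * (1 - 4 * X / real d ^ 3) \<le> \<gamma> * (1 - \<gamma>) * (\<Sum>j<T. (1 - 4 * \<delta>) ^ j)"
  proof -
    \<comment> \<open>By Bernoulli's inequality even the smallest summand is at least
      \<open>1 - 4 * \<delta> * T\<close>.\<close>
    have "(\<Sum>j<T. 1 - 4 * \<delta> * T) \<le> (\<Sum>j<T. (1 - 4 * \<delta>) ^ j)"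
    proof (rule sum_mono)
      fix j assume "j \<in> {..<T}"
      then have "\<delta> * j \<le> \<delta> * T" using \<delta> by (intro mult_left_mono) auto
      moreover have "1 - 4 * (\<delta> * j) \<le> (1 - 4 * \<delta>) ^ j"
        using Bernoulli_inequality[of "- (4 * \<delta>)" j] \<delta> \<gamma> by (simp add: mult_ac)
      ultimately show "1 - 4 * \<delta> * T \<le> (1 - 4 * \<delta>) ^ j" by linarith
    qed
    then have S: "T * (1 - 4 * \<delta> * T) \<le> (\<Sum>j<T. (1 - 4 * \<delta>) ^ j)" by simp
    have nn: "0 \<le> 1 - 4 * X / real d ^ 3" using X d0 by simp
    have "(X - 1 / real d ^ 4) * (1 - \<gamma>) * (1 - 4 * X / real d ^ 3) \<le> (\<gamma> * T) * (1 - \<gamma>) * (1 - 4 * \<delta> * T)"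
      using \<gamma>T \<delta>T nn \<gamma> X by (intro mult_mono mult_nonneg_nonneg) auto
    also have "\<dots> = \<gamma> * (1 - \<gamma>) * (T * (1 - 4 * \<delta> * T))" by (simp add: mult_ac)
    also have "\<dots> \<le> \<gamma> * (1 - \<gamma>) * (\<Sum>j<T. (1 - 4 * \<delta>) ^ j)"
      using S \<gamma> by (intro mult_left_mono mult_nonneg_nonneg) auto
    finally show ?thesis by (simp add: \<gamma>_def)
  qed
  then have "(X - 1 / real d ^ 4) * (1 - 1 / real d ^ 4) * (1 - 4 * X / real d ^ 3) / D * real (card V)
      \<le> \<gamma> * (1 - \<gamma>) * (\<Sum>j<T. (1 - 4 * \<delta>) ^ j) / D * real (card V)"
    using D0 by (intro mult_right_mono divide_right_mono) auto
  ultimately have low: "(X - 1 / real d ^ 4) * (1 - 1 / real d ^ 4) * (1 - 4 * X / real d ^ 3) / D * (real d ^ 4) ^ d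
      \<le> real (indep_num ?E V)"
    unfolding cardV by linarith
  obtain I where I: "I \<subseteq> V" "indep ?E I" "card I = indep_num ?E V"
    using indep_num_attained[OF finV] by blast
  \<comment> \<open>Rescales the grid so that the graph distance \<open>2 * d ^ 2\<close> becomes
    \<open>2 * r_d d\<close>.\<close>
  define h where "h = r_d d / real d ^ 2"
  have h: "0 < h" using r d0 by (simp add: h_def)
  have "ereal (real (card I) / (h * real (d ^ 4 + 2 * d ^ 2)) ^ d) \<le> theta d"
  proof (rule theta_ge_periodic[OF d0(1) h])
    show "2 * r_d d \<le> h * real (2 * d ^ 2)" using d0 by (simp add: h_def)
    show "I \<subseteq> Pi\<^sub>E {..<d} (\<lambda>_. {0..<int (d ^ 4)})" using I by (simp add: V_def)
    show "real (2 * d ^ 2) \<le> L2_set (\<lambda>i. real_of_int (x i - y i)) {..<d}"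
      if "x \<in> I" "y \<in> I" "x \<noteq> y" for x y
      using I(2) that unfolding indep_def ldist_def by force
  qed
  moreover have "(X - 1 / real d ^ 4) * (1 - 1 / real d ^ 4) * (1 - 4 * X / real d ^ 3)
      * (real d ^ 4 / (real d ^ 4 + 2 * real d ^ 2)) ^ d * (real d ^ 2 / (2 * real d ^ 2 + sqrt d)) ^ d
      \<le> real (card I) / (h * real (d ^ 4 + 2 * d ^ 2)) ^ d"
  proof -
    let ?a = "(X - 1 / real d ^ 4) * (1 - 1 / real d ^ 4) * (1 - 4 * X / real d ^ 3)" and ?H = "h * real (d ^ 4 + 2 * d ^ 2)"
    have z: "0 < real d ^ 4 + 2 * real d ^ 2" using d0 by (intro add_pos_pos) auto
    have H: "0 < ?H" using h z by simp
    have y: "0 < 2 * real d ^ 2 + sqrt d" using d0 by (intro add_pos_pos) auto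
    \<comment> \<open>The first factor is the volume lost to the margins of the periodic tiling. The
      second is about 1/2; its \<open>d\<close>-th power supplies the main factor
      \<open>2 ^ d\<close> in the denominator.\<close>
    have "(real d ^ 4 / (real d ^ 4 + 2 * real d ^ 2)) * (real d ^ 2 / (2 * real d ^ 2 + sqrt d))
        = real d ^ 4 / ((2 * real d ^ 2 + sqrt d) / r_d d) / ?H"
      using r y z d0 by (simp add: h_def divide_simps)
    then have "(real d ^ 4 / (real d ^ 4 + 2 * real d ^ 2)) ^ d * (real d ^ 2 / (2 * real d ^ 2 + sqrt d)) ^ d = (real d ^ 4) ^ d / D / ?H ^ d"
      unfolding D_def power_mult_distrib[symmetric] power_divide[symmetric] by simp
    then have "?a * (real d ^ 4 / (real d ^ 4 + 2 * real d ^ 2)) ^ d * (real d ^ 2 / (2 * real d ^ 2 + sqrt d)) ^ d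
        = ?a / D * (real d ^ 4) ^ d / ?H ^ d" by (simp add: mult.assoc)
    also have "\<dots> \<le> real (card I) / ?H ^ d" using low I(3) H by (intro divide_right_mono) auto
    finally show ?thesis .
  qed
  ultimately show ?thesis by (meson ereal_less_eq(3) order_trans)
qed

section \<open>Asymptotic choice of the parameters\<close>

theorem theorem1p1:
  shows "\<forall>\<epsilon>>0. \<exists>d0::nat. \<forall>d\<ge>d0.
           theta d \<ge> ereal ((1 - \<epsilon>) * (real d * ln (real d)) / 2 ^ (d + 1))"
proof (intro allI impI)
  fix \<epsilon> :: real assume "\<epsilon> > 0"
  \<comment> \<open>Strictly below both \<open>\<epsilon>\<close> and 1: the gap to
    \<open>\<epsilon>\<close> absorbs all lower order losses, and \<open>X\<close> stays
    positive.\<close>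
  define \<eta> where "\<eta> = min \<epsilon> 1 / 2"
  have \<eta>: "0 < \<eta>" "\<eta> < \<epsilon>" "\<eta> < 1" using \<open>\<epsilon> > 0\<close> by (auto simp: \<eta>_def)
  \<comment> \<open>The available time is \<open>ln (D / K)\<close>, asymptotically
    \<open>d * ln d / 2\<close> for the \<open>\<sigma>\<close> below; \<open>\<eta>\<close> leaves
    room for the error terms. The density obtained is about \<open>X d / 2 ^ d\<close>.\<close>
  define X where "X d = (1 - \<eta>) / 2 * (real d * ln (real d))" for d :: nat
  \<comment> \<open>The factor \<open>ln d\<close> makes the codegree ratio decay roughly like
    \<open>exp (- (ln d)^2 / 32)\<close>, faster than any power of \<open>d\<close>, while changing
    \<open>ln (D / K)\<close> only by \<open>d * ln (ln d)\<close>.\<close>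
  define \<sigma> where "\<sigma> d = real d * sqrt (real d) * ln (real d)" for d :: nat
  let ?ev = "\<lambda>P. eventually P (sequentially :: nat filter)"
  have d: "?ev (\<lambda>d. 8 \<le> d)" by (rule eventually_ge_at_top)
  have ln1: "?ev (\<lambda>d. 1 \<le> ln (real d))" by real_asymp
  have X1: "?ev (\<lambda>d. 1 / real d ^ 4 \<le> X d)" using \<eta> unfolding X_def by real_asymp
  have X2: "?ev (\<lambda>d. 2 * (real d * ln (real d)) \<le> real d ^ 3)" by real_asymp
  have \<sigma>: "?ev (\<lambda>d. \<sigma> d \<le> 4 * real d ^ 2)" unfolding \<sigma>_def by real_asymp
  \<comment> \<open>This condition and the next two are the last hypotheses of
    \<open>theta_ge_nibble\<close> in logarithmic form; they are exponentiated below through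
    \<open>pow\<close> and \<open>lnp\<close>.\<close>
  have codeg: "?ev (\<lambda>d. real d * ln ((sqrt ((2 * real d ^ 2)\<^sup>2 - (\<sigma> d)\<^sup>2 / 4) + sqrt (real d)) / (2 * real d ^ 2 + sqrt (real d)))
       + 14 * ln (real d) \<le> 0)"
    unfolding \<sigma>_def by real_asymp
  have close: "?ev (\<lambda>d. ln 4 + 31 * ln (real d) + X d
       \<le> real d * ln ((2 * real d ^ 2 + sqrt (real d)) / (\<sigma> d + sqrt (real d))))"
    using \<eta> unfolding \<sigma>_def X_def by real_asymp
  have union: "?ev (\<lambda>d. ln 2 + 4 * real d * ln (real d) - real d ^ 3 / 4 \<le> - 7 * ln (real d))"
    by real_asymp
  \<comment> \<open>All correction factors that tend to 1. In the last one the factor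
    \<open>2 ^ d\<close> has been moved into the numerator, and \<open>4 * X d / d ^ 3\<close> is
    replaced by its upper bound \<open>2 * ln d / d ^ 2\<close>.\<close>
  define g where "g d = (1 - 1 / real d ^ 4) * (1 - 2 * ln (real d) / real d ^ 2)
      * (real d ^ 4 / (real d ^ 4 + 2 * real d ^ 2)) ^ d * (2 * real d ^ 2 / (2 * real d ^ 2 + sqrt (real d))) ^ d" for d :: nat
  have "(\<lambda>d. (1 - \<eta> - 2 / (real d ^ 4 * (real d * ln (real d)))) * g d) \<longlonglongrightarrow> (1 - \<eta>) * 1"
  proof (rule tendsto_mult)
    show "(\<lambda>d. 1 - \<eta> - 2 / (real d ^ 4 * (real d * ln (real d)))) \<longlonglongrightarrow> 1 - \<eta>" by real_asymp
    show "g \<longlonglongrightarrow> 1" unfolding g_def by real_asymp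
  qed
  then have main: "?ev (\<lambda>d. 1 - \<epsilon> < (1 - \<eta> - 2 / (real d ^ 4 * (real d * ln (real d)))) * g d)"
    using \<eta> by (intro order_tendstoD(1)) auto
  have "?ev (\<lambda>d. theta d \<ge> ereal ((1 - \<epsilon>) * (real d * ln (real d)) / 2 ^ (d + 1)))"
    using d ln1 X1 X2 \<sigma> codeg close union main
  proof eventually_elim
    case (elim d)
    let ?l = "real d * ln (real d)"
    have d0: "0 < real d" "1 \<le> real d" using elim(1) by auto
    have ln0: "0 < ln (real d)" using elim(2) by linarith
    have l: "0 < ?l" using d0 ln0 by (intro mult_pos_pos)
    have Xl: "X d \<le> ?l / 2" using \<eta> l by (simp add: X_def field_simps)
    have \<sigma>0: "0 < \<sigma> d" using d0 ln0 unfolding \<sigma>_def by (intro mult_pos_pos) auto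
    have pow: "x ^ d = exp (real d * ln x)" if "0 < x" for x :: real
      using that by (simp add: exp_of_nat_mult)
    have lnp: "real d ^ n = exp (real n * ln (real d))" for n
      using d0 by (simp add: exp_of_nat_mult)
    have sq: "0 < sqrt (real d)" using d0 by simp
    have "ereal ((X d - 1 / real d ^ 4) * (1 - 1 / real d ^ 4) * (1 - 4 * X d / real d ^ 3)
      * (real d ^ 4 / (real d ^ 4 + 2 * real d ^ 2)) ^ d * (real d ^ 2 / (2 * real d ^ 2 + sqrt d)) ^ d) \<le> theta d"
    proof (rule theta_ge_nibble[OF elim(1) elim(3) _ \<sigma>0 elim(5)])
      show "4 * X d \<le> real d ^ 3" using Xl elim(4) by linarith
      have "(\<sigma> d)\<^sup>2 \<le> (4 * real d ^ 2)\<^sup>2" using \<sigma>0 elim(5) by (intro power_mono) auto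
      then have "0 \<le> (2 * real d ^ 2)\<^sup>2 - (\<sigma> d)\<^sup>2 / 4" by (simp add: power_mult_distrib)
      then have q: "0 < (sqrt ((2 * real d ^ 2)\<^sup>2 - (\<sigma> d)\<^sup>2 / 4) + sqrt d) / (2 * real d ^ 2 + sqrt d)"
        using sq d0 by (intro divide_pos_pos add_nonneg_pos) auto
      have "((sqrt ((2 * real d ^ 2)\<^sup>2 - (\<sigma> d)\<^sup>2 / 4) + sqrt d) / (2 * real d ^ 2 + sqrt d)) ^ d
          \<le> exp (- (real 14 * ln (real d)))"
        unfolding pow[OF q] using elim(6) by simp
      then show "((sqrt ((2 * real d ^ 2)\<^sup>2 - (\<sigma> d)\<^sup>2 / 4) + sqrt d) / (2 * real d ^ 2 + sqrt d)) ^ d \<le> 1 / real d ^ 14"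
        unfolding lnp[of 14] by (simp only: exp_minus inverse_eq_divide)
      have q': "0 < (2 * real d ^ 2 + sqrt d) / (\<sigma> d + sqrt d)"
        using sq d0 \<sigma>0 by (intro divide_pos_pos add_pos_pos) auto
      have "exp (ln 4 + real 31 * ln (real d) + X d) \<le> ((2 * real d ^ 2 + sqrt d) / (\<sigma> d + sqrt d)) ^ d"
        unfolding pow[OF q'] using elim(7) by simp
      then show "4 * real d ^ 31 * exp (X d) \<le> ((2 * real d ^ 2 + sqrt d) / (\<sigma> d + sqrt d)) ^ d"
        unfolding lnp[of 31] by (simp add: exp_add)
      have "1 + (real d ^ 4) ^ d \<le> 2 * (real d ^ 4) ^ d" using one_le_power[OF one_le_power[OF d0(2)]] by simp
      also have "\<dots> = exp (ln 2 + 4 * real d * ln (real d))"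
        using lnp[of "4 * d"] by (simp add: exp_add flip: power_mult)
      finally have "(1 + (real d ^ 4) ^ d) * exp (- (real d ^ 3 / 4))
          \<le> exp (ln 2 + 4 * real d * ln (real d)) * exp (- (real d ^ 3 / 4))"
        by (intro mult_right_mono) auto
      also have "\<dots> \<le> exp (- (real 7 * ln (real d)))"
        using elim(8) by (simp flip: exp_add)
      finally show "(1 + (real d ^ 4) ^ d) * exp (- (real d ^ 3 / 4)) \<le> 1 / real d ^ 7"
        unfolding lnp[of 7] by (simp only: exp_minus inverse_eq_divide)
    qed
    moreover have "(1 - \<epsilon>) * ?l / 2 ^ (d + 1) \<le> (X d - 1 / real d ^ 4) * (1 - 1 / real d ^ 4) * (1 - 4 * X d / real d ^ 3)
      * (real d ^ 4 / (real d ^ 4 + 2 * real d ^ 2)) ^ d * (real d ^ 2 / (2 * real d ^ 2 + sqrt d)) ^ d"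
    proof -
      \<comment> \<open>Rewrites \<open>X d - 1 / d ^ 4\<close> as a multiple of
        \<open>?l / 2\<close>, the form in which \<open>main\<close> gives the limit.\<close>
      have alg: "(1 - \<eta> - 2 / (x * y)) * (y / 2) = (1 - \<eta>) / 2 * y - 1 / x" if "y \<noteq> 0" for x y :: real
        using that by (simp add: left_diff_distrib)
      let ?B = "(real d ^ 4 / (real d ^ 4 + 2 * real d ^ 2)) ^ d" and ?F = "(real d ^ 2 / (2 * real d ^ 2 + sqrt d)) ^ d"
      have F: "(2 * real d ^ 2 / (2 * real d ^ 2 + sqrt d)) ^ d = 2 ^ d * ?F"
        by (simp add: power_divide power_mult_distrib)
      have "(1 - \<epsilon>) * ?l / 2 ^ (d + 1) = (1 - \<epsilon>) * (?l / 2 ^ (d + 1))" by simp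
      also have "\<dots> \<le> (1 - \<eta> - 2 / (real d ^ 4 * ?l)) * g d * (?l / 2 ^ (d + 1))"
        using elim(9) l by (intro mult_right_mono) auto
      also have "\<dots> = ((1 - \<eta> - 2 / (real d ^ 4 * ?l)) * (?l / 2)) * (g d / 2 ^ d)" by simp
      also have "(1 - \<eta> - 2 / (real d ^ 4 * ?l)) * (?l / 2) = X d - 1 / real d ^ 4"
        unfolding X_def by (rule alg[OF less_imp_neq[OF l, symmetric]])
      also have "(X d - 1 / real d ^ 4) * (g d / 2 ^ d) =
          (X d - 1 / real d ^ 4) * (1 - 1 / real d ^ 4) * (1 - 2 * ln (real d) / real d ^ 2) * ?B * ?F"
        unfolding g_def F by simp
      also have "\<dots> \<le> (X d - 1 / real d ^ 4) * (1 - 1 / real d ^ 4) * (1 - 4 * X d / real d ^ 3) * ?B * ?F"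
      proof (intro mult_right_mono mult_left_mono mult_nonneg_nonneg)
        have "4 * X d / real d ^ 3 \<le> (2 * ?l) / real d ^ 3" using Xl d0 by (intro divide_right_mono) auto
        also have "\<dots> = 2 * ln (real d) / real d ^ 2" using d0 by (simp add: power3_eq_cube power2_eq_square)
        finally show "1 - 2 * ln (real d) / real d ^ 2 \<le> 1 - 4 * X d / real d ^ 3" by simp
      qed (use elim(3) d0 in auto)
      finally show ?thesis by simp
    qed
    ultimately show ?case by (meson ereal_less_eq(3) order_trans)
  qed
  then show "\<exists>d0. \<forall>d\<ge>d0. theta d \<ge> ereal ((1 - \<epsilon>) * (real d * ln (real d)) / 2 ^ (d + 1))"
    by (simp add: eventually_sequentially)
qed

end
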